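(* Let $d\geq 1$. Then the interior of $\mathrm{BD}^{d}$ equals $\mathrm{ED}^{d}$, i.e. $\operatorname{int}\mathrm{BD}^{d}=\mathrm{ED}^{d}$, where the interior is taken in $\mathcal{L}^{\mathrm{Lya}}(\mathbb{N},\mathbb{R}^{d\times d})$ with the topology of uniform convergence (induced by $\|\cdot\|_\infty$).
   Context: $\mathbb{N}=\{0,1,2,\dots\}$. $\|\cdot\|$ is the Euclidean norm on $\mathbb{R}^d$ and the induced operator norm on $\mathbb{R}^{d\times d}$. $\mathcal{L}^\infty(\mathbb{N},\mathbb{R}^{d\times d})$ is the Banach space of bounded sequences $B=(B(n))_{n\in\mathbb{N}}$ in $\mathbb{R}^{d\times d}$ with norm $\|B\|_\infty=\sup_n\|B(n)\|$. $\mathcal{L}^{\mathrm{Lya}}(\mathbb{N},\mathbb{R}^{d\times d})$ is the set of sequences $B$ of invertible matrices such that both $B$ and $B^{-1}:=(B(n)^{-1})_{n}$ are bounded; it is an open subset of $\mathcal{L}^\infty(\mathbb{N},\mathbb{R}^{d\times d})$. For $A\in\mathcal{L}^{\mathrm{Lya}}(\mathbb{N},\mathbb{R}^{d\times d})$, $(x(n,x_0))_{n\in\mathbb{N}}$ denotes the solution of $x(n+1)=A(n)x(n)$ with $x(0)=x_0$. Exponential dichotomy: $A\in\mathrm{ED}^d$ iff $A\in\mathcal{L}^{\mathrm{Lya}}(\mathbb{N},\mathbb{R}^{d\times d})$ and there exist subspaces $L_1,L_2\subseteq\mathbb{R}^d$ with $\mathbb{R}^d=L_1\oplus L_2$, $\alpha>0$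 and $K>0$ such that for all $n\ge m$: $\|x(n,x_0)\|\le Ke^{-\alpha(n-m)}\|x(m,x_0)\|$ for all $x_0\in L_1$, and $\|x(n,x_0)\|\ge K^{-1}e^{\alpha(n-m)}\|x(m,x_0)\|$ for all $x_0\in L_2$. Bohl dichotomy: $A\in\mathrm{BD}^d$ iff $A\in\mathcal{L}^{\mathrm{Lya}}(\mathbb{N},\mathbb{R}^{d\times d})$ and there exist subspaces $L_1,L_2\subseteq\mathbb{R}^d$ with $\mathbb{R}^d=L_1\oplus L_2$, $\alpha>0$ and functions $C_1,C_2:\mathbb{R}^d\to(0,\infty)$ such that for all $n\ge m$: $\|x(n,x_0)\|\le C_1(x_0)e^{-\alpha(n-m)}\|x(m,x_0)\|$ for all $x_0\in L_1$, and $\|x(n,x_0)\|\ge C_2(x_0)e^{\alpha(n-m)}\|x(m,x_0)\|$ for all $x_0\in L_2$. *)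

theory Defs
  imports "HOL-Analysis.Analysis"
begin

text \<open>The library norm on \<open>real^'d^'d\<close> is the Frobenius norm, so the operator norm induced by
  the Euclidean norm has to be named separately.\<close>

definition mat_opnorm :: "real^'d^'d \<Rightarrow> real" where
  "mat_opnorm M = onorm (\<lambda>v. M *v v)"

definition Linf :: "(nat \<Rightarrow> real^'d^'d) set" where
  "Linf = {B. bdd_above (range (\<lambda>n. mat_opnorm (B n)))}"

definition Linf_norm :: "(nat \<Rightarrow> real^'d^'d) \<Rightarrow> real" where
  "Linf_norm B = (SUP n. mat_opnorm (B n))"

text \<open>Outside \<^const>\<open>Linf\<close> the supremum is unspecified; the value \<open>0\<close> there only serves the
  requirement of the locale \<^locale>\<open>Metric_space\<close> that the distance function be nonnegative
  and symmetric on the whole type.\<close>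

definition Linf_dist :: "(nat \<Rightarrow> real^'d^'d) \<Rightarrow> (nat \<Rightarrow> real^'d^'d) \<Rightarrow> real" where
  "Linf_dist B C = (if B \<in> Linf \<and> C \<in> Linf then Linf_norm (\<lambda>n. B n - C n) else 0)"

definition LLya :: "(nat \<Rightarrow> real^'d^'d) set" where
  "LLya = {B. (\<forall>n. invertible (B n)) \<and> B \<in> Linf \<and> (\<lambda>n. matrix_inv (B n)) \<in> Linf}"

definition LLya_topology :: "(nat \<Rightarrow> real^'d^'d) topology" where
  "LLya_topology = subtopology (Metric_space.mtopology Linf Linf_dist) LLya"

primrec sol :: "(nat \<Rightarrow> real^'d^'d) \<Rightarrow> real^'d \<Rightarrow> nat \<Rightarrow> real^'d" where
  "sol A x0 0 = x0"
| "sol A x0 (Suc n) = A n *v sol A x0 n"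

definition direct_sum_decomp :: "(real^'d) set \<Rightarrow> (real^'d) set \<Rightarrow> bool" where
  "direct_sum_decomp L1 L2 \<longleftrightarrow>
     subspace L1 \<and> subspace L2 \<and> {x + y | x y. x \<in> L1 \<and> y \<in> L2} = UNIV \<and> L1 \<inter> L2 = {0}"

definition ED :: "(nat \<Rightarrow> real^'d^'d) set" where
  "ED = {A. A \<in> LLya \<and>
     (\<exists>L1 L2. direct_sum_decomp L1 L2 \<and>
       (\<exists>\<alpha>>0. \<exists>K>0. \<forall>n m. m \<le> n \<longrightarrow>
          (\<forall>x0\<in>L1. norm (sol A x0 n) \<le> K * exp (- \<alpha> * real (n - m)) * norm (sol A x0 m)) \<and>
          (\<forall>x0\<in>L2. norm (sol A x0 n) \<ge> inverse K * exp (\<alpha> * real (n - m)) * norm (sol A x0 m))))}"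

definition BD :: "(nat \<Rightarrow> real^'d^'d) set" where
  "BD = {A. A \<in> LLya \<and>
     (\<exists>L1 L2. direct_sum_decomp L1 L2 \<and>
       (\<exists>\<alpha>>0. \<exists>C1 C2 :: real^'d \<Rightarrow> real. (\<forall>x. C1 x > 0) \<and> (\<forall>x. C2 x > 0) \<and>
          (\<forall>n m. m \<le> n \<longrightarrow>
            (\<forall>x0\<in>L1. norm (sol A x0 n) \<le> C1 x0 * exp (- \<alpha> * real (n - m)) * norm (sol A x0 m)) \<and>
            (\<forall>x0\<in>L2. norm (sol A x0 n) \<ge> C2 x0 * exp (\<alpha> * real (n - m)) * norm (sol A x0 m)))))}"

lemma mat_opnorm_nonneg: "mat_opnorm M \<ge> 0"
  unfolding mat_opnorm_def by (intro onorm_pos_le matrix_vector_mul_bounded_linear)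

lemma mat_opnorm_eq_0: "mat_opnorm M = 0 \<longleftrightarrow> M = 0"
  unfolding mat_opnorm_def onorm_eq_0[OF matrix_vector_mul_bounded_linear]
  by (metis matrix_eq matrix_vector_mult_0)

lemma mat_opnorm_triangle: "mat_opnorm (M + N) \<le> mat_opnorm M + mat_opnorm N"
  unfolding mat_opnorm_def matrix_vector_mult_add_rdistrib
  by (intro onorm_triangle matrix_vector_mul_bounded_linear)

lemma mat_opnorm_minus: "mat_opnorm (- M) = mat_opnorm M"
proof -
  have "(\<lambda>v. (- M) *v v) = (\<lambda>v. - (M *v v))"
    by (metis (no_types) add.right_inverse matrix_vector_mult_0 matrix_vector_mult_add_rdistrib
        minus_unique)
  then show ?thesis
    unfolding mat_opnorm_def by (simp add: onorm_neg)
qed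

lemma mat_opnorm_minus_commute: "mat_opnorm (M - N) = mat_opnorm (N - M)"
  using mat_opnorm_minus[of "M - N"] by simp

lemma Linf_diff: "B \<in> Linf \<Longrightarrow> C \<in> Linf \<Longrightarrow> (\<lambda>n. B n - C n) \<in> Linf"
proof -
  assume "B \<in> Linf" "C \<in> Linf"
  then obtain b c where b: "\<And>n. mat_opnorm (B n) \<le> b" and c: "\<And>n. mat_opnorm (C n) \<le> c"
    unfolding Linf_def bdd_above_def by auto
  have "mat_opnorm (B n - C n) \<le> b + c" for n
    using mat_opnorm_triangle[of "B n" "- C n"] b[of n] c[of n] by (simp add: mat_opnorm_minus)
  then show ?thesis unfolding Linf_def bdd_above_def by auto
qed

lemma mat_opnorm_le_Linf_norm: "B \<in> Linf \<Longrightarrow> mat_opnorm (B n) \<le> Linf_norm B"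
  unfolding Linf_def Linf_norm_def by (auto intro: cSUP_upper)

lemma Metric_space_Linf: "Metric_space Linf Linf_dist"
proof
  fix B C :: "nat \<Rightarrow> real^'d^'d"
  show "0 \<le> Linf_dist B C"
    using order_trans[OF mat_opnorm_nonneg mat_opnorm_le_Linf_norm[OF Linf_diff]]
    by (auto simp: Linf_dist_def)
  show "Linf_dist B C = Linf_dist C B"
    by (auto simp: Linf_dist_def Linf_norm_def mat_opnorm_minus_commute)
next
  fix B C :: "nat \<Rightarrow> real^'d^'d"
  assume BC: "B \<in> Linf" "C \<in> Linf"
  show "Linf_dist B C = 0 \<longleftrightarrow> B = C"
  proof
    assume "Linf_dist B C = 0"
    then have "mat_opnorm (B n - C n) = 0" for n
      using mat_opnorm_le_Linf_norm[OF Linf_diff[OF BC], of n] BC mat_opnorm_nonneg[of "B n - C n"]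
      by (simp add: Linf_dist_def)
    then show "B = C" by (simp add: mat_opnorm_eq_0 fun_eq_iff)
  next
    assume "B = C"
    moreover have "mat_opnorm (0 :: real^'d^'d) = 0" by (simp add: mat_opnorm_eq_0)
    ultimately show "Linf_dist B C = 0" by (simp add: Linf_dist_def Linf_norm_def)
  qed
next
  fix B C D :: "nat \<Rightarrow> real^'d^'d"
  assume BCD: "B \<in> Linf" "C \<in> Linf" "D \<in> Linf"
  have "Linf_norm (\<lambda>n. B n - D n) \<le> Linf_norm (\<lambda>n. B n - C n) + Linf_norm (\<lambda>n. C n - D n)"
    unfolding Linf_norm_def[of "\<lambda>n. B n - D n"]
  proof (rule cSUP_least)
    fix n
    show "mat_opnorm (B n - D n) \<le> Linf_norm (\<lambda>n. B n - C n) + Linf_norm (\<lambda>n. C n - D n)"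
      using mat_opnorm_triangle[of "B n - C n" "C n - D n"]
        mat_opnorm_le_Linf_norm[OF Linf_diff[OF BCD(1,2)], of n]
        mat_opnorm_le_Linf_norm[OF Linf_diff[OF BCD(2,3)], of n]
      by simp
  qed simp
  then show "Linf_dist B D \<le> Linf_dist B C + Linf_dist C D"
    using BCD by (simp add: Linf_dist_def)
qed

end

theory Submission
  imports Defs
begin

text \<open>An exponential dichotomy is equivalent to a uniform discrete convexity of the norms of solutions:
  for some \<open>N\<close>, the norm at each time is dominated by a fraction of its maximum \<open>N\<close> steps earlier and
  \<open>N\<close> steps later. This involves only solutions over \<open>2 N\<close> steps, so it survives small perturbations.

  Conversely, let a neighbourhood of \<open>A\<close> consist of Bohl dichotomies while the estimates for \<open>A\<close> on
  \<open>L\<^sub>1\<close> or on \<open>L\<^sub>2\<close> are not uniform. Then there are arbitrarily long and late time windows with solutions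
  that hardly decay, respectively hardly grow. Small kicks at sparse times produce one pseudo-orbit that
  has such a window infinitely often, and that decays, respectively grows, in long windows in
  between. A rank one perturbation of \<open>A\<close> turns the pseudo-orbit into a solution, which is
  impossible for a Bohl dichotomy.\<close>

section \<open>Two-sided bounds and solutions\<close>

text \<open>The constants of a Bohl dichotomy belong to single solutions and may degenerate as the
  initial value runs over the unit sphere. Compactness of the sphere yields a waiting time that is
  uniform over solutions for each fixed starting time only; it may tend to infinity with the
  starting time. This dictates the sparse kicks: after each kick one waits out the bound belonging
  to that moment. Uniformity from some time on would suffice, because the two-sided bounds on the
  matrices absorb an initial segment; hence its failure supplies arbitrarily late windows. A kick
  has a fixed relative size, so the decay or growth across the window is limited by a factor that
  does not depend on the length of the window. For ever longer windows this contradicts the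
  exponential rate of the one solution that is built, whichever subspaces belong to the perturbed
  system. In the other direction, the convexity criterion mentions no subspaces, so no projections
  have to be perturbed; the subspaces are recovered at the end from the bounded solutions.\<close>

definition Lya_bound :: "(nat \<Rightarrow> real^'d^'d) \<Rightarrow> real \<Rightarrow> bool" where
  "Lya_bound A a \<longleftrightarrow> 1 \<le> a \<and> (\<forall>n v. norm (A n *v v) \<le> a * norm v \<and> norm v \<le> a * norm (A n *v v))"

lemma norm_mult_vec_le_mat_opnorm: "norm (M *v v) \<le> mat_opnorm M * norm v"
  unfolding mat_opnorm_def by (rule onorm) (rule matrix_vector_mul_bounded_linear)

lemma mat_opnorm_le: "(\<And>v. norm (M *v v) \<le> b * norm v) \<Longrightarrow> mat_opnorm M \<le> b"
  unfolding mat_opnorm_def by (rule onorm_le)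

lemma Linf_iff: "B \<in> Linf \<longleftrightarrow> (\<exists>b. \<forall>n v. norm (B n *v v) \<le> b * norm v)"
proof
  assume "B \<in> Linf"
  then have "norm (B n *v v) \<le> Linf_norm B * norm v" for n v
    by (meson mat_opnorm_le_Linf_norm mult_right_mono norm_ge_zero norm_mult_vec_le_mat_opnorm order_trans)
  then show "\<exists>b. \<forall>n v. norm (B n *v v) \<le> b * norm v" by blast
next
  assume "\<exists>b. \<forall>n v. norm (B n *v v) \<le> b * norm v"
  then show "B \<in> Linf"
    unfolding Linf_def bdd_above_def using mat_opnorm_le by blast
qed

lemma matrix_inv_mult_vec:
  assumes "invertible (M :: real^'d^'d)"
  shows "matrix_inv M *v (M *v v) = v" "M *v (matrix_inv M *v v) = v"
proof -
  have "\<exists>M'. M ** M' = mat 1 \<and> M' ** M = mat 1"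
    using assms by (simp add: invertible_def)
  then have "M ** matrix_inv M = mat 1 \<and> matrix_inv M ** M = mat 1"
    unfolding matrix_inv_def by (rule someI_ex)
  then show "matrix_inv M *v (M *v v) = v" "M *v (matrix_inv M *v v) = v"
    by (simp_all add: matrix_vector_mul_assoc)
qed

lemma invertible_if_bounded_below:
  assumes "\<And>v. norm v \<le> a * norm (M *v v)"
  shows "invertible (M :: real^'d^'d)"
proof -
  have "v = 0" if "M *v v = 0" for v
    using assms[of v] that by simp
  then have "inj ((*v) M)"
    by (simp add: vec.inj_iff_eq_0)
  then show ?thesis
    by (simp add: invertible_left_inverse matrix_left_invertible_injective)
qed

text \<open>A square matrix that is bounded below is invertible, and the lower bound is a bound on
  its inverse. From here on a single constant stands for both boundedness conditions.\<close>

lemma LLya_iff: "A \<in> LLya \<longleftrightarrow> (\<exists>a. Lya_bound A a)"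
proof
  assume "A \<in> LLya"
  then have inv: "\<And>n. invertible (A n)" and "A \<in> Linf" "(\<lambda>n. matrix_inv (A n)) \<in> Linf"
    by (auto simp: LLya_def)
  then obtain b c where b: "\<And>n v. norm (A n *v v) \<le> b * norm v"
    and c: "\<And>n v. norm (matrix_inv (A n) *v v) \<le> c * norm v"
    unfolding Linf_iff by auto
  define a where "a = max 1 (max b c)"
  have "norm (A n *v v) \<le> a * norm v" for n v
    by (rule order_trans[OF b]) (auto simp: a_def intro!: mult_right_mono)
  moreover have "norm v \<le> a * norm (A n *v v)" for n v
  proof -
    have "norm v \<le> c * norm (A n *v v)"
      using c[of n "A n *v v"] inv[of n] by (simp add: matrix_inv_mult_vec)
    also have "\<dots> \<le> a * norm (A n *v v)"
      by (auto simp: a_def intro!: mult_right_mono)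
    finally show ?thesis .
  qed
  ultimately have "Lya_bound A a" by (simp add: Lya_bound_def a_def)
  then show "\<exists>a. Lya_bound A a" ..
next
  assume "\<exists>a. Lya_bound A a"
  then obtain a where a: "\<And>n v. norm (A n *v v) \<le> a * norm v" "\<And>n v. norm v \<le> a * norm (A n *v v)"
    unfolding Lya_bound_def by blast
  have inv: "invertible (A n)" for n
    using a(2) by (rule invertible_if_bounded_below)
  have "norm (matrix_inv (A n) *v v) \<le> a * norm v" for n v
    using a(2)[of "matrix_inv (A n) *v v" n] inv by (simp add: matrix_inv_mult_vec)
  then show "A \<in> LLya"
    using a(1) inv unfolding LLya_def Linf_iff by blast
qed

lemma sol_add: "sol A (x + y) n = sol A x n + sol A y n"
  by (induction n) (simp_all add: matrix_vector_right_distrib)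

lemma sol_scaleR: "sol A (c *\<^sub>R x) n = c *\<^sub>R sol A x n"
  by (induction n) (simp_all add: matrix_vector_mult_scaleR)

lemma linear_sol: "linear (\<lambda>x. sol A x n)"
  by (intro linearI sol_add sol_scaleR)

lemma sol_0 [simp]: "sol A 0 n = 0"
  by (rule linear_0[OF linear_sol])

lemma continuous_on_sol [continuous_intros]:
  "continuous_on S f \<Longrightarrow> continuous_on S (\<lambda>x. sol A (f x) n)"
  by (rule continuous_on_compose2[of UNIV "\<lambda>x. sol A x n"])
    (simp_all add: linear_continuous_on linear_conv_bounded_linear[symmetric] linear_sol)

lemma sol_shift: "sol A x (m + j) = sol (\<lambda>i. A (m + i)) (sol A x m) j"
  by (induction j) simp_all

text \<open>Doubling once per block of \<open>N\<close> steps is the rate \<open>ln 2 / N\<close>;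
  the leading factor 2 pays for the incomplete last block.\<close>

lemma exp_bounds_div:
  fixes N k :: nat
  assumes "0 < N"
  defines "\<alpha> \<equiv> ln 2 / real N"
  shows "exp (\<alpha> * real k) \<le> 2 * 2 ^ (k div N)"
proof -
  have "k \<le> N * Suc (k div N)"
    using assms(1) by (simp add: dividend_less_times_div less_imp_le)
  then have "real k \<le> real N * real (Suc (k div N))"
    by (metis of_nat_le_iff of_nat_mult)
  then have "\<alpha> * real k \<le> real (Suc (k div N)) * ln 2"
    using assms(1) mult_right_mono[of "real k" "real N * real (Suc (k div N))" "ln 2"]
    by (simp add: \<alpha>_def field_simps)
  then have "exp (\<alpha> * real k) \<le> exp (real (Suc (k div N)) * ln 2)" by simp
  also have "\<dots> = 2 * 2 ^ (k div N)"
    by (simp only: exp_of_nat_mult) simp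
  finally show ?thesis .
qed

lemma exp_large:
  fixes \<alpha> :: real
  assumes "0 < \<alpha>"
  shows "\<exists>k. \<forall>n\<ge>k. r < exp (\<alpha> * real n)"
proof -
  obtain k where k: "r < real k * \<alpha>" using reals_Archimedean3[OF assms] by blast
  have "r < exp (\<alpha> * real n)" if "k \<le> n" for n
  proof -
    have "real k * \<alpha> \<le> \<alpha> * real n"
      using that assms by (simp add: mult.commute)
    with k exp_ge_add_one_self[of "\<alpha> * real n"] show ?thesis by linarith
  qed
  then show ?thesis by blast
qed

context
  fixes A :: "nat \<Rightarrow> real^'d^'d" and a :: real
  assumes A: "Lya_bound A a"
begin

lemma Lya_bound_ge_1: "1 \<le> a"
  using A by (simp add: Lya_bound_def)

lemma Lya_bound_shift: "Lya_bound (\<lambda>i. A (m + i)) a"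
  using A by (simp add: Lya_bound_def)

lemma sol_Suc_bounds:
  "norm (sol A x (Suc n)) \<le> a * norm (sol A x n)"
  "norm (sol A x n) \<le> a * norm (sol A x (Suc n))"
  using A by (auto simp: Lya_bound_def)

lemma sol_le: "norm (sol A x (m + j)) \<le> a ^ j * norm (sol A x m)"
proof (induction j)
  case (Suc j)
  have "norm (sol A x (m + Suc j)) \<le> a * norm (sol A x (m + j))"
    using sol_Suc_bounds(1)[of x "m + j"] by simp
  also have "\<dots> \<le> a * (a ^ j * norm (sol A x m))"
    using Suc Lya_bound_ge_1 by (intro mult_left_mono) auto
  finally show ?case by (simp add: mult.assoc)
qed simp

lemma sol_ge: "norm (sol A x m) \<le> a ^ j * norm (sol A x (m + j))"
proof (induction j)
  case (Suc j)
  have "a ^ j * norm (sol A x (m + j)) \<le> a ^ j * (a * norm (sol A x (m + Suc j)))"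
    using sol_Suc_bounds(2)[of x "m + j"] Lya_bound_ge_1 by (intro mult_left_mono) auto
  with Suc show ?case by (simp add: mult_ac)
qed simp

lemma sol_eq_0_iff: "sol A x n = 0 \<longleftrightarrow> x = 0"
  using sol_ge[of x 0 n] by auto

lemma sol_surj: "\<exists>x. sol A x n = v"
proof (induction n arbitrary: v)
  case (Suc n)
  have "invertible (A n)"
    using A by (intro invertible_if_bounded_below[where a = a]) (simp add: Lya_bound_def)
  moreover obtain x where "sol A x n = matrix_inv (A n) *v v"
    using Suc by blast
  ultimately have "sol A x (Suc n) = v"
    by (simp add: matrix_inv_mult_vec)
  then show ?case by blast
qed simp

section \<open>A uniform criterion for exponential dichotomy\<close>

text \<open>The first \<open>m0\<close> steps can enlarge a solution by at most
  \<open>a ^ m0\<close>, so enough blocks to gain \<open>2 * a ^ m0\<close> are appended to them.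
  The longer block then works from every starting time.\<close>

lemma uniform_decay_from_0:
  assumes "0 < N"
    and decay: "\<And>m x. m0 \<le> m \<Longrightarrow> x \<in> L \<Longrightarrow> 2 * norm (sol A x (m + N)) \<le> norm (sol A x m)"
  obtains N' where "0 < N'" "\<And>m x. x \<in> L \<Longrightarrow> 2 * norm (sol A x (m + N')) \<le> norm (sol A x m)"
proof -
  have blocks: "2 ^ q * norm (sol A x (m + q * N)) \<le> norm (sol A x m)" if "m0 \<le> m" "x \<in> L" for m q x
  proof (induction q)
    case (Suc q)
    have "2 ^ Suc q * norm (sol A x (m + Suc q * N)) = 2 ^ q * (2 * norm (sol A x (m + q * N + N)))"
      by (simp add: algebra_simps)
    also have "\<dots> \<le> 2 ^ q * norm (sol A x (m + q * N))"
      using that by (intro mult_left_mono decay) auto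
    also note Suc
    finally show ?case .
  qed simp
  obtain q where q: "2 * a ^ m0 < 2 ^ q"
    using real_arch_pow[of 2 "2 * a ^ m0"] by auto
  have bound: "2 * norm (sol A x (m + (m0 + q * N))) \<le> norm (sol A x m)" if "x \<in> L" for m x
  proof -
    let ?y = "norm (sol A x (m + (m0 + q * N)))"
    have "a ^ m0 * (2 * ?y) \<le> 2 ^ q * ?y"
      using mult_right_mono[OF less_imp_le[OF q], of ?y] by (simp add: mult_ac)
    also have "\<dots> \<le> norm (sol A x (m + m0))"
      using blocks[of "m + m0" x q] that by (simp add: add.assoc)
    also have "\<dots> \<le> a ^ m0 * norm (sol A x m)" by (rule sol_le)
    finally show ?thesis
      using Lya_bound_ge_1 by (simp add: mult_le_cancel_left)
  qed
  \<comment> \<open>Keeps the new block length positive also when \<open>m0 = 0\<close>.\<close>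
  have "q \<noteq> 0"
  proof
    assume "q = 0"
    then have "2 * a ^ m0 < 1" using q by simp
    then show False using one_le_power[OF Lya_bound_ge_1, of m0] by linarith
  qed
  then have pos: "0 < m0 + q * N" using \<open>0 < N\<close> by simp
  show thesis by (rule that[OF pos bound])
qed

lemma uniform_growth_from_0:
  assumes "0 < N"
    and growth: "\<And>m x. m0 \<le> m \<Longrightarrow> x \<in> L \<Longrightarrow> 2 * norm (sol A x m) \<le> norm (sol A x (m + N))"
  obtains N' where "0 < N'" "\<And>m x. x \<in> L \<Longrightarrow> 2 * norm (sol A x m) \<le> norm (sol A x (m + N'))"
proof -
  have blocks: "2 ^ q * norm (sol A x m) \<le> norm (sol A x (m + q * N))" if "m0 \<le> m" "x \<in> L" for m q x
  proof (induction q)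
    case (Suc q)
    have "2 * norm (sol A x (m + q * N)) \<le> norm (sol A x (m + q * N + N))"
      using that by (intro growth) auto
    with Suc show ?case by (simp add: algebra_simps)
  qed simp
  obtain q where q: "2 * a ^ m0 < 2 ^ q"
    using real_arch_pow[of 2 "2 * a ^ m0"] by auto
  have bound: "2 * norm (sol A x m) \<le> norm (sol A x (m + (m0 + q * N)))" if "x \<in> L" for m x
  proof -
    have "2 * norm (sol A x m) \<le> 2 * a ^ m0 * norm (sol A x (m + m0))"
      using sol_ge[of x m m0] by simp
    also have "\<dots> \<le> 2 ^ q * norm (sol A x (m + m0))"
      using q by (intro mult_right_mono) auto
    also have "\<dots> \<le> norm (sol A x (m + (m0 + q * N)))"
      using blocks[of "m + m0" x q] that by (simp add: add.assoc)
    finally show ?thesis .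
  qed
  have "q \<noteq> 0"
  proof
    assume "q = 0"
    then have "2 * a ^ m0 < 1" using q by simp
    then show False using one_le_power[OF Lya_bound_ge_1, of m0] by linarith
  qed
  then have pos: "0 < m0 + q * N" using \<open>0 < N\<close> by simp
  show thesis by (rule that[OF pos bound])
qed

text \<open>The incomplete block has fewer than \<open>N\<close> steps and costs at most
  \<open>a ^ N\<close>; the 2 comes from rounding the number of blocks down.\<close>

lemma uniform_decay_imp_exponential:
  assumes "0 < N" "x \<in> L"
    and decay: "\<And>m x. x \<in> L \<Longrightarrow> 2 * norm (sol A x (m + N)) \<le> norm (sol A x m)"
  shows "norm (sol A x (m + k)) \<le> 2 * a ^ N * exp (- (ln 2 / real N) * real k) * norm (sol A x m)"
proof -
  have blocks: "2 ^ q * norm (sol A x (m + q * N)) \<le> norm (sol A x m)" for q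
  proof (induction q)
    case (Suc q)
    have "2 ^ Suc q * norm (sol A x (m + Suc q * N)) = 2 ^ q * (2 * norm (sol A x (m + q * N + N)))"
      by (simp add: algebra_simps)
    also have "\<dots> \<le> 2 ^ q * norm (sol A x (m + q * N))"
      using \<open>x \<in> L\<close> by (intro mult_left_mono decay) auto
    also note Suc
    finally show ?case .
  qed simp
  let ?q = "k div N" and ?r = "k mod N"
  let ?y = "norm (sol A x (m + k))" and ?E = "exp (ln 2 / real N * real k)"
  have k: "m + k = (m + ?q * N) + ?r" by simp
  have "?y \<le> a ^ ?r * norm (sol A x (m + ?q * N))"
    by (subst k) (rule sol_le)
  also have "\<dots> \<le> a ^ N * norm (sol A x (m + ?q * N))"
    using Lya_bound_ge_1 \<open>0 < N\<close> by (intro mult_right_mono power_increasing) (auto simp: less_imp_le)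
  finally have y: "?y \<le> a ^ N * norm (sol A x (m + ?q * N))" .
  have "?E * ?y \<le> 2 * 2 ^ ?q * (a ^ N * norm (sol A x (m + ?q * N)))"
    using exp_bounds_div[OF \<open>0 < N\<close>, of k] y by (intro mult_mono) auto
  also have "\<dots> \<le> 2 * a ^ N * norm (sol A x m)"
    using mult_left_mono[OF blocks[of ?q], of "2 * a ^ N"] Lya_bound_ge_1 by (simp add: mult_ac)
  finally show ?thesis
    by (simp add: exp_minus field_simps)
qed

lemma uniform_growth_imp_exponential:
  assumes "0 < N" "x \<in> L"
    and growth: "\<And>m x. x \<in> L \<Longrightarrow> 2 * norm (sol A x m) \<le> norm (sol A x (m + N))"
  shows "inverse (2 * a ^ N) * exp (ln 2 / real N * real k) * norm (sol A x m) \<le> norm (sol A x (m + k))"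
proof -
  have blocks: "2 ^ q * norm (sol A x m) \<le> norm (sol A x (m + q * N))" for q
  proof (induction q)
    case (Suc q)
    with growth[OF \<open>x \<in> L\<close>, of "m + q * N"] show ?case by (simp add: algebra_simps)
  qed simp
  let ?q = "k div N" and ?r = "k mod N"
  let ?y = "norm (sol A x (m + k))" and ?E = "exp (ln 2 / real N * real k)"
  have k: "m + k = (m + ?q * N) + ?r" by simp
  have "norm (sol A x (m + ?q * N)) \<le> a ^ ?r * ?y"
    by (subst k) (rule sol_ge)
  also have "\<dots> \<le> a ^ N * ?y"
    using Lya_bound_ge_1 \<open>0 < N\<close> by (intro mult_right_mono power_increasing) (auto simp: less_imp_le)
  finally have y: "norm (sol A x (m + ?q * N)) \<le> a ^ N * ?y" .
  have "?E * norm (sol A x m) \<le> 2 * 2 ^ ?q * norm (sol A x m)"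
    using exp_bounds_div[OF \<open>0 < N\<close>, of k] by (intro mult_right_mono) auto
  also have "\<dots> \<le> 2 * a ^ N * ?y"
    using order_trans[OF blocks[of ?q] y] by simp
  finally show ?thesis
    using Lya_bound_ge_1 by (simp add: field_simps)
qed

text \<open>Both inclusions end here: with subspaces built from bounded solutions for openness, and
  with the subspaces of the Bohl dichotomy for the converse.\<close>

lemma uniform_imp_ED:
  assumes "direct_sum_decomp L1 L2" "0 < N1" "0 < N2"
    and decay: "\<And>m x. m1 \<le> m \<Longrightarrow> x \<in> L1 \<Longrightarrow> 2 * norm (sol A x (m + N1)) \<le> norm (sol A x m)"
    and growth: "\<And>m x. m2 \<le> m \<Longrightarrow> x \<in> L2 \<Longrightarrow> 2 * norm (sol A x m) \<le> norm (sol A x (m + N2))"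
  shows "A \<in> ED"
proof -
  obtain N where N: "0 < N" "\<And>m x. x \<in> L1 \<Longrightarrow> 2 * norm (sol A x (m + N)) \<le> norm (sol A x m)"
    using uniform_decay_from_0[OF \<open>0 < N1\<close> decay] by blast
  obtain M where M: "0 < M" "\<And>m x. x \<in> L2 \<Longrightarrow> 2 * norm (sol A x m) \<le> norm (sol A x (m + M))"
    using uniform_growth_from_0[OF \<open>0 < N2\<close> growth] by blast
  define \<alpha> where "\<alpha> = min (ln 2 / real N) (ln 2 / real M)"
  define K where "K = max (2 * a ^ N) (2 * a ^ M)"
  have "0 < \<alpha>" using N M by (simp add: \<alpha>_def)
  have \<alpha>: "\<alpha> * real k \<le> ln 2 / real N * real k" "\<alpha> * real k \<le> ln 2 / real M * real k" for k
    by (auto simp: \<alpha>_def simp del: times_divide_eq_left intro!: mult_right_mono)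
  have "0 < a ^ N" "0 < a ^ M" using Lya_bound_ge_1 by auto
  then have "0 < K" by (simp add: K_def)
  have 1: "norm (sol A x n) \<le> K * exp (- \<alpha> * real (n - m)) * norm (sol A x m)"
    if "m \<le> n" "x \<in> L1" for m n x
  proof -
    have "norm (sol A x n) \<le> 2 * a ^ N * exp (- (ln 2 / real N) * real (n - m)) * norm (sol A x m)"
      using uniform_decay_imp_exponential[OF N(1) \<open>x \<in> L1\<close> N(2), where m = m and k = "n - m"] \<open>m \<le> n\<close> by simp
    also have "\<dots> \<le> K * exp (- \<alpha> * real (n - m)) * norm (sol A x m)"
      using \<open>0 < K\<close> \<alpha>(1)[of "n - m"] by (intro mult_right_mono mult_mono) (auto simp: K_def)
    finally show ?thesis .
  qed
  have 2: "norm (sol A x n) \<ge> inverse K * exp (\<alpha> * real (n - m)) * norm (sol A x m)"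
    if "m \<le> n" "x \<in> L2" for m n x
  proof -
    have "inverse K * exp (\<alpha> * real (n - m)) * norm (sol A x m)
      \<le> inverse (2 * a ^ M) * exp (ln 2 / real M * real (n - m)) * norm (sol A x m)"
      using \<open>0 < a ^ M\<close> \<alpha>(2)[of "n - m"]
      by (intro mult_right_mono mult_mono le_imp_inverse_le) (auto simp: K_def)
    also have "\<dots> \<le> norm (sol A x n)"
      using uniform_growth_imp_exponential[OF M(1) \<open>x \<in> L2\<close> M(2), where m = m and k = "n - m"] \<open>m \<le> n\<close> by simp
    finally show ?thesis .
  qed
  have "A \<in> LLya" using A LLya_iff by blast
  moreover have "\<forall>n m. m \<le> n \<longrightarrow>
          (\<forall>x0\<in>L1. norm (sol A x0 n) \<le> K * exp (- \<alpha> * real (n - m)) * norm (sol A x0 m)) \<and>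
          (\<forall>x0\<in>L2. norm (sol A x0 n) \<ge> inverse K * exp (\<alpha> * real (n - m)) * norm (sol A x0 m))"
    by (intro allI impI conjI ballI 1 2; assumption)
  ultimately show ?thesis
    unfolding ED_def using assms(1) \<open>0 < \<alpha>\<close> \<open>0 < K\<close> by blast
qed

end

section \<open>Exponential dichotomy is an open condition\<close>

text \<open>Compactness of the unit sphere of \<open>L\<close> replaces an index depending on the
  vector by a common one; invariance under positive scaling carries the result from the sphere to
  all nonzero vectors.\<close>

lemma subspace_uniform_index:
  fixes L :: "'a::euclidean_space set" and U :: "nat \<Rightarrow> 'a set"
  assumes L: "subspace L" and opn: "\<And>k. open (U k)" and "mono U"
    and cover: "\<And>x. x \<in> L \<Longrightarrow> x \<noteq> 0 \<Longrightarrow> \<exists>k. x \<in> U k"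
    and cone: "\<And>k c x. x \<in> U k \<Longrightarrow> 0 < c \<Longrightarrow> c *\<^sub>R x \<in> U k"
  obtains k where "L - {0} \<subseteq> U k"
proof -
  let ?S = "L \<inter> sphere 0 1"
  have "compact ?S"
    using closed_subspace[OF L] by (intro closed_Int_compact) auto
  moreover have "?S \<subseteq> (\<Union>k\<in>UNIV. U k)" using cover by fastforce
  ultimately obtain D where D: "finite D" "?S \<subseteq> (\<Union>k\<in>D. U k)"
    using opn by (elim compactE_image[where C = UNIV and f = U]) auto
  define k where "k = Max (insert 0 D)"
  have "U i \<subseteq> U k" if "i \<in> D" for i
    using D(1) that by (intro monoD[OF \<open>mono U\<close>]) (auto simp: k_def)
  with D(2) have S: "?S \<subseteq> U k" by blast
  have "x \<in> U k" if "x \<in> L" "x \<noteq> 0" for x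
  proof -
    have "inverse (norm x) *\<^sub>R x \<in> ?S"
      using that L by (auto simp: subspace_scale)
    with S have "inverse (norm x) *\<^sub>R x \<in> U k" by blast
    from cone[OF this, of "norm x"] that show ?thesis by simp
  qed
  then show thesis using that by blast
qed

text \<open>Each window is restarted at its left end with an arbitrary vector, so that perturbation
  estimates apply to it without reference to time 0. Since every vector is reached by a solution,
  nothing is lost.\<close>

definition convex_norms :: "(nat \<Rightarrow> real^'d^'d) \<Rightarrow> nat \<Rightarrow> real \<Rightarrow> bool" where
  "convex_norms A N c \<longleftrightarrow> (\<forall>m v. c * norm (sol (\<lambda>i. A (m + i)) v N)
      \<le> max (norm v) (norm (sol (\<lambda>i. A (m + i)) v (N + N))))"

lemma convex_normsD:
  "convex_norms A N c \<Longrightarrow> c * norm (sol A x (m + N)) \<le> max (norm (sol A x m)) (norm (sol A x (m + N + N)))"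
  unfolding convex_norms_def by (metis sol_shift add.assoc)

text \<open>If \<open>x = p + q\<close> with \<open>p\<close> decaying and \<open>q\<close> growing, then the larger of the two at the middle
  time dominates at one of the two end times; no bound on the angle between them is needed.\<close>

lemma ED_imp_convex_norms:
  assumes "A \<in> ED"
  obtains N where "0 < N" "convex_norms A N 4"
proof -
  from assms obtain L1 L2 \<alpha> K where "A \<in> LLya" and L: "direct_sum_decomp L1 L2"
    and "0 < \<alpha>" "0 < K"
    and dich: "\<forall>n m. m \<le> n \<longrightarrow>
          (\<forall>x0\<in>L1. norm (sol A x0 n) \<le> K * exp (- \<alpha> * real (n - m)) * norm (sol A x0 m)) \<and>
          (\<forall>x0\<in>L2. norm (sol A x0 n) \<ge> inverse K * exp (\<alpha> * real (n - m)) * norm (sol A x0 m))"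
    unfolding ED_def by blast
  obtain a where a: "Lya_bound A a" using \<open>A \<in> LLya\<close> LLya_iff by blast
  \<comment> \<open>Over \<open>N\<close> steps the dominant component gains at least
    \<open>8 + K\<close>, while the other one is at most \<open>K\<close> times the dominant one at
    the middle time. The difference 8 becomes 4, because the whole solution is at most twice its
    dominant component there.\<close>
  obtain N where N: "K * (8 + K) < real N * \<alpha>"
    using reals_Archimedean3[OF \<open>0 < \<alpha>\<close>] by blast
  have "0 < K * (8 + K)" using \<open>0 < K\<close> by simp
  with N have "0 < N" by (intro gr0I) auto
  have E: "K * (8 + K) \<le> exp (\<alpha> * real N)"
    using N exp_ge_add_one_self[of "\<alpha> * real N"] unfolding mult.commute[of \<alpha>] by linarith
  have E': "exp (- \<alpha> * real N) \<le> 1" using \<open>0 < \<alpha>\<close> by simp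
  have L1le: "norm (sol A p (m + N)) \<le> K * norm (sol A p m)" if "p \<in> L1" for p m
  proof -
    have "norm (sol A p (m + N)) \<le> K * exp (- \<alpha> * real N) * norm (sol A p m)"
      using dich[rule_format, of m "m + N"] that by simp
    also have "\<dots> \<le> K * 1 * norm (sol A p m)"
      using E' \<open>0 < K\<close> by (intro mult_right_mono mult_left_mono) auto
    finally show ?thesis by simp
  qed
  have L1ge: "(8 + K) * norm (sol A p (m + N)) \<le> norm (sol A p m)" if "p \<in> L1" for p m
  proof -
    have *: "norm (sol A p (m + N)) \<le> K * exp (- \<alpha> * real N) * norm (sol A p m)"
      using dich[rule_format, of m "m + N"] that by simp
    have "K * (8 + K) * norm (sol A p (m + N)) \<le> exp (\<alpha> * real N) * norm (sol A p (m + N))"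
      using E by (rule mult_right_mono) simp
    also have "\<dots> \<le> exp (\<alpha> * real N) * (K * exp (- \<alpha> * real N) * norm (sol A p m))"
      using * by (rule mult_left_mono) simp
    also have "\<dots> = K * norm (sol A p m)"
      by (simp add: exp_minus)
    finally show ?thesis using \<open>0 < K\<close> by (simp add: mult.assoc)
  qed
  have L2ge: "(8 + K) * norm (sol A q m) \<le> norm (sol A q (m + N))" if "q \<in> L2" for q m
  proof -
    have *: "inverse K * exp (\<alpha> * real N) * norm (sol A q m) \<le> norm (sol A q (m + N))"
      using dich[rule_format, of m "m + N"] that by simp
    have "(8 + K) \<le> inverse K * exp (\<alpha> * real N)"
      using E \<open>0 < K\<close> by (simp add: field_simps)
    then show ?thesis
      by (meson * mult_right_mono norm_ge_zero order_trans)
  qed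
  have L2le: "norm (sol A q m) \<le> K * norm (sol A q (m + N))" if "q \<in> L2" for q m
  proof -
    have "inverse K * 1 * norm (sol A q m) \<le> inverse K * exp (\<alpha> * real N) * norm (sol A q m)"
      using \<open>0 < K\<close> \<open>0 < \<alpha>\<close> by (intro mult_right_mono mult_left_mono) auto
    also have "\<dots> \<le> norm (sol A q (m + N))"
      using dich[rule_format, of m "m + N"] that by simp
    finally show ?thesis using \<open>0 < K\<close> by (simp add: field_simps)
  qed
  have "4 * norm (sol A x (m + N)) \<le> max (norm (sol A x m)) (norm (sol A x (m + N + N)))" for x m
  proof -
    obtain p q where pq: "p \<in> L1" "q \<in> L2" and x: "x = p + q"
      using L unfolding direct_sum_decomp_def by blast
    let ?p = "sol A p" and ?q = "sol A q"
    show ?thesis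
    proof (cases "norm (?p (m + N)) \<le> norm (?q (m + N))")
      case True
      have "norm (?p (m + N + N)) \<le> K * norm (?q (m + N))"
        using L1le[OF pq(1), of "m + N"] True \<open>0 < K\<close>
        by (meson mult_left_mono less_imp_le order_trans)
      moreover have "(8 + K) * norm (?q (m + N)) \<le> norm (?q (m + N + N))"
        using L2ge[OF pq(2)] .
      moreover have "norm (?q (m + N + N)) \<le> norm (sol A x (m + N + N)) + norm (?p (m + N + N))"
        unfolding x sol_add by (metis add.commute norm_triangle_ineq4 add_diff_cancel_left')
      moreover have "norm (sol A x (m + N)) \<le> 2 * norm (?q (m + N))"
        unfolding x sol_add using True norm_triangle_ineq[of "?p (m + N)" "?q (m + N)"] by linarith
      ultimately show ?thesis by (simp add: distrib_right)
    next
      case False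
      have "norm (?q m) \<le> K * norm (?p (m + N))"
        using L2le[OF pq(2), of m] False \<open>0 < K\<close>
        by (meson mult_left_mono less_imp_le order_trans linear)
      moreover have "(8 + K) * norm (?p (m + N)) \<le> norm (?p m)"
        using L1ge[OF pq(1)] .
      moreover have "norm (?p m) \<le> norm (sol A x m) + norm (?q m)"
        unfolding x sol_add by (metis norm_triangle_ineq4 add_diff_cancel_right')
      moreover have "norm (sol A x (m + N)) \<le> 2 * norm (?p (m + N))"
        unfolding x sol_add using False norm_triangle_ineq[of "?p (m + N)" "?q (m + N)"] by linarith
      ultimately show ?thesis by (simp add: distrib_right)
    qed
  qed
  then have "convex_norms A N 4"
    unfolding convex_norms_def by (metis sol_surj[OF a] sol_shift add.assoc)
  with \<open>0 < N\<close> show thesis by (rule that)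
qed

text \<open>Along times spaced by \<open>N\<close>, a norm that has increased once doubles ever
  after. Hence a bounded solution never increases and must halve, which is already uniform, whereas
  an unbounded one eventually doubles at an onset that varies with the solution. Only the latter
  needs compactness.\<close>

lemma convex_norms_imp_ED:
  assumes a: "Lya_bound A a" and "0 < N" and conv: "convex_norms A N 2"
  shows "A \<in> ED"
proof -
  \<comment> \<open>When the left norm is below the middle one, the maximum in the convexity
    estimate has to be the right norm. So an increase propagates to the next \<open>N\<close>
    steps.\<close>
  define G where "G x m \<longleftrightarrow> norm (sol A x m) < norm (sol A x (m + N))" for x m
  have step: "2 * norm (sol A x (m + N)) \<le> norm (sol A x (m + N + N))" if "G x m" for x m
    using convex_normsD[OF conv, of x m] that norm_ge_zero[of "sol A x m"] unfolding G_def by linarith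
  have G_next: "G x (m + N)" if "G x m" for x m
    using step[OF that] that unfolding G_def by (smt (verit) norm_ge_zero)
  have G_iter: "G x (m + j * N)" if "G x m" for x m j
  proof (induction j)
    case (Suc j)
    then show ?case using G_next[of x "m + j * N"] by (simp add: algebra_simps)
  qed (simp add: that)
  define L1 where "L1 = {x. bounded (range (sol A x))}"
  have G_unbounded: "x \<notin> L1" if "G x m" for x m
  proof
    assume "x \<in> L1"
    then obtain c where c: "\<And>n. norm (sol A x n) \<le> c"
      unfolding L1_def bounded_iff by auto
    have pos: "0 < norm (sol A x (m + N))"
      using that unfolding G_def by (smt (verit) norm_ge_zero)
    have pow: "2 ^ j * norm (sol A x (m + N)) \<le> norm (sol A x (m + N + j * N))" for j
    proof (induction j)
      case (Suc j)
      have "2 * norm (sol A x (m + j * N + N)) \<le> norm (sol A x (m + j * N + N + N))"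
        by (rule step[OF G_iter[OF that]])
      with Suc show ?case by (simp add: algebra_simps)
    qed simp
    obtain j where "c / norm (sol A x (m + N)) < 2 ^ j"
      using real_arch_pow[of 2] by auto
    then have "c < 2 ^ j * norm (sol A x (m + N))"
      using pos by (simp add: pos_divide_less_eq)
    then show False
      using pow[of j] c[of "m + N + j * N"] by linarith
  qed
  \<comment> \<open>A single residue class modulo \<open>N\<close> without an increase bounds the
    whole solution, since every time is reached from that class in at most \<open>N\<close> steps at
    a cost of at most \<open>a ^ N\<close>.\<close>
  have unbounded_G: "\<exists>j. G x (r + j * N)" if "x \<notin> L1" "r < N" for x r
  proof (rule ccontr)
    assume "\<not> ?thesis"
    then have "norm (sol A x (r + j * N + N)) \<le> norm (sol A x (r + j * N))" for j
      unfolding G_def by (meson not_le)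
    then have dec: "norm (sol A x (r + j * N)) \<le> norm (sol A x r)" for j
      by (induction j) (simp_all add: algebra_simps, meson order_trans)
    have "norm (sol A x n) \<le> a ^ N * norm (sol A x r)" for n
    proof (cases "r \<le> n")
      case True
      define j s where "j = (n - r) div N" and "s = (n - r) mod N"
      have n: "n = r + j * N + s" using True by (simp add: j_def s_def)
      have "s < N" using \<open>0 < N\<close> by (simp add: s_def)
      have "norm (sol A x n) \<le> a ^ s * norm (sol A x (r + j * N))"
        unfolding n by (rule sol_le[OF a])
      also have "\<dots> \<le> a ^ N * norm (sol A x r)"
        using dec \<open>s < N\<close> Lya_bound_ge_1[OF a] by (intro mult_mono power_increasing) auto
      finally show ?thesis .
    next
      case False
      then have "norm (sol A x n) \<le> a ^ (r - n) * norm (sol A x r)"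
        using sol_ge[OF a, of x n "r - n"] by simp
      also have "\<dots> \<le> a ^ N * norm (sol A x r)"
        using that Lya_bound_ge_1[OF a] by (intro mult_right_mono power_increasing) auto
      finally show ?thesis .
    qed
    then have "x \<in> L1" unfolding L1_def bounded_iff by auto
    with that show False by blast
  qed
  have "subspace L1"
  proof (rule subspaceI)
    fix x y
    assume "x \<in> L1" "y \<in> L1"
    then obtain b b' where b: "\<And>n. norm (sol A x n) \<le> b" "\<And>n. norm (sol A y n) \<le> b'"
      unfolding L1_def bounded_iff by auto
    have "norm (sol A (x + y) n) \<le> b + b'" for n
      unfolding sol_add by (rule norm_triangle_mono[OF b])
    then show "x + y \<in> L1" unfolding L1_def bounded_iff by auto
  next
    fix x c
    assume "x \<in> L1"
    then obtain b where b: "\<And>n. norm (sol A x n) \<le> b"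
      unfolding L1_def bounded_iff by auto
    have "norm (sol A (c *\<^sub>R x) n) \<le> \<bar>c\<bar> * b" for n
      by (simp add: sol_scaleR mult_left_mono b)
    then show "c *\<^sub>R x \<in> L1" unfolding L1_def bounded_iff by auto
  qed (simp add: L1_def image_def)
  have decay: "2 * norm (sol A x (m + N)) \<le> norm (sol A x m)" if "x \<in> L1" for x m
  proof -
    have "norm (sol A x (m + N + N)) \<le> norm (sol A x (m + N))"
      using G_unbounded[of x "m + N"] that unfolding G_def not_less[symmetric] by blast
    then show ?thesis
      using convex_normsD[OF conv, of x m] norm_ge_zero[of "sol A x m"] by linarith
  qed
  \<comment> \<open>A complement of the bounded solutions meets them only in 0, so all its nonzero
    elements start unbounded solutions.\<close>
  define L2 where "L2 = L1\<^sup>\<bottom>"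
  have "subspace L2" by (simp add: L2_def subspace_orthogonal_comp)
  have "L1 \<inter> L2 = {0}"
    using subspace_0[OF \<open>subspace L1\<close>] subspace_0[OF \<open>subspace L2\<close>]
    by (auto simp: L2_def orthogonal_comp_def orthogonal_def)
  have "{x + y | x y. x \<in> L1 \<and> y \<in> L2} = UNIV"
    using subspace_sum_orthogonal_comp[OF \<open>subspace L1\<close>]
    by (fastforce simp: L2_def set_plus_def set_eq_iff)
  then have L: "direct_sum_decomp L1 L2"
    unfolding direct_sum_decomp_def
    using \<open>subspace L1\<close> \<open>subspace L2\<close> \<open>L1 \<inter> L2 = {0}\<close> by blast
  \<comment> \<open>One time from each residue class: an increase at these \<open>N\<close>
    consecutive times propagates to all later times. The sets are monotone because the time
    \<open>k\<close> that is dropped implies the time \<open>k + N\<close> that enters.\<close>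
  define U where "U k = (\<Inter>m\<in>{k..<k + N}. {x. G x m})" for k
  obtain k where k: "L2 - {0} \<subseteq> U k"
  proof (rule subspace_uniform_index[OF \<open>subspace L2\<close>, of U])
    show "open (U k)" for k
      unfolding U_def G_def by (intro open_INT ballI open_Collect_less continuous_intros) auto
    have "U k \<subseteq> U (Suc k)" for k
    proof
      fix x
      assume x: "x \<in> U k"
      have "G x m" if "m \<in> {Suc k..<Suc k + N}" for m
      proof (cases "m = k + N")
        case True
        then show ?thesis using x \<open>0 < N\<close> G_next[of x k] by (auto simp: U_def)
      next
        case False
        then show ?thesis using x that by (auto simp: U_def)
      qed
      then show "x \<in> U (Suc k)" by (auto simp: U_def)
    qed
    then show "mono U" by (rule incseq_SucI)
  next
    fix x
    assume "x \<in> L2" "x \<noteq> 0"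
    then have "x \<notin> L1" using \<open>L1 \<inter> L2 = {0}\<close> by blast
    then obtain j where j: "\<And>r. r < N \<Longrightarrow> G x (r + j r * N)"
      using unbounded_G by metis
    define J where "J = Max (j ` {..<N})"
    have "G x m" if "m \<in> {J * N..<J * N + N}" for m
    proof -
      define r where "r = m - J * N"
      have r: "r < N" using that by (auto simp: r_def)
      then have "j r \<le> J" by (simp add: J_def)
      then have "m = r + j r * N + (J - j r) * N"
        using that by (simp add: r_def algebra_simps flip: distrib_right)
      then show ?thesis using G_iter[OF j[OF r]] by metis
    qed
    then have "x \<in> U (J * N)" by (auto simp: U_def)
    then show "\<exists>k. x \<in> U k" ..
  next
    show "c *\<^sub>R x \<in> U k" if "x \<in> U k" "0 < c" for k c x
      using that by (auto simp: U_def G_def sol_scaleR)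
  qed blast
  \<comment> \<open>Doubling from \<open>m\<close> to \<open>m + N\<close> comes from an increase
    between \<open>m - N\<close> and \<open>m\<close>, hence the extra \<open>N\<close> in the
    threshold.\<close>
  have growth: "2 * norm (sol A x m) \<le> norm (sol A x (m + N))" if "k + N \<le> m" "x \<in> L2" for m x
  proof (cases "x = 0")
    case False
    define s j where "s = (m - N - k) mod N" and "j = (m - N - k) div N"
    have "s < N" using \<open>0 < N\<close> by (simp add: s_def)
    with False that k have "G x (k + s)" by (auto simp: U_def)
    then have "G x (k + s + j * N)" by (rule G_iter)
    moreover have "k + s + j * N = m - N"
      using that by (simp add: s_def j_def add.assoc)
    ultimately show ?thesis using step[of x "m - N"] that by simp
  qed simp
  show ?thesis
    by (rule uniform_imp_ED[OF a L \<open>0 < N\<close> \<open>0 < N\<close> decay growth])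
qed

section \<open>Robustness of the convexity criterion and of the Lyapunov bounds\<close>

text \<open>Each step adds a defect of relative size \<open>\<epsilon>\<close>, and
  \<open>a + 1\<close> bounds both systems because \<open>\<epsilon> \<le> 1\<close>. The crude
  factor suffices: the number of steps stays fixed while \<open>\<epsilon>\<close> is made
  small.\<close>

lemma sol_perturb:
  assumes a: "Lya_bound A a" and close: "\<And>n v. norm (B n *v v - A n *v v) \<le> \<epsilon> * norm v"
    and \<epsilon>: "0 \<le> \<epsilon>" "\<epsilon> \<le> 1"
  shows "norm (sol B v j - sol A v j) \<le> j * (a + 1) ^ j * \<epsilon> * norm v"
proof -
  have B: "norm (sol B v j) \<le> (a + 1) ^ j * norm v" for j
  proof (induction j)
    case (Suc j)
    let ?x = "sol B v j"
    have "norm (B j *v ?x) \<le> norm (A j *v ?x) + norm (B j *v ?x - A j *v ?x)"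
      by (metis add.commute diff_add_cancel norm_triangle_ineq)
    also have "\<dots> \<le> a * norm ?x + 1 * norm ?x"
      using a close[of j ?x] mult_right_mono[OF \<epsilon>(2), of "norm ?x"]
      by (intro add_mono) (auto simp: Lya_bound_def intro: order_trans)
    also have "\<dots> \<le> (a + 1) * ((a + 1) ^ j * norm v)"
      using mult_left_mono[OF Suc, of "a + 1"] Lya_bound_ge_1[OF a] by (simp add: algebra_simps)
    finally show ?case by (simp add: mult_ac)
  qed simp
  show ?thesis
  proof (induction j)
    case (Suc j)
    let ?x = "sol B v j" and ?y = "sol A v j"
    have "B j *v ?x - A j *v ?y = (B j *v ?x - A j *v ?x) + A j *v (?x - ?y)"
      by (simp add: matrix_vector_mult_diff_distrib)
    then have "norm (B j *v ?x - A j *v ?y) \<le> norm (B j *v ?x - A j *v ?x) + norm (A j *v (?x - ?y))"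
      by (metis norm_triangle_ineq)
    also have "\<dots> \<le> \<epsilon> * norm ?x + a * norm (?x - ?y)"
      using a close by (intro add_mono) (auto simp: Lya_bound_def)
    also have "\<dots> \<le> \<epsilon> * ((a + 1) ^ Suc j * norm v) + (a + 1) * (j * (a + 1) ^ j * \<epsilon> * norm v)"
    proof (intro add_mono mult_mono)
      have "norm ?x \<le> (a + 1) ^ j * norm v" by (rule B)
      also have "\<dots> \<le> (a + 1) ^ Suc j * norm v"
        using Lya_bound_ge_1[OF a] by (intro mult_right_mono power_increasing) auto
      finally show "norm ?x \<le> (a + 1) ^ Suc j * norm v" .
    qed (use Suc \<epsilon> Lya_bound_ge_1[OF a] in auto)
    also have "\<dots> = Suc j * (a + 1) ^ Suc j * \<epsilon> * norm v"
      by (simp add: algebra_simps)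
    finally show ?case by simp
  qed simp
qed

text \<open>Errors of at most an eighth of \<open>norm v\<close> at the middle and right times fit
  into the gap between the constants 4 and 2.\<close>

lemma convex_norms_perturb:
  assumes a: "Lya_bound A a" and close: "\<And>n v. norm (B n *v v - A n *v v) \<le> \<epsilon> * norm v"
    and \<epsilon>: "0 \<le> \<epsilon>" "\<epsilon> \<le> 1" "8 * (real (N + N) * (a + 1) ^ (N + N) * \<epsilon>) \<le> 1"
    and conv: "convex_norms A N 4"
  shows "convex_norms B N 2"
  unfolding convex_norms_def
proof (intro allI)
  fix m v
  define c where "c = real (N + N) * (a + 1) ^ (N + N) * \<epsilon>"
  let ?x = "sol (\<lambda>i. B (m + i)) v" and ?y = "sol (\<lambda>i. A (m + i)) v"
  have diff: "norm (?x j - ?y j) \<le> norm v / 8" if "j \<le> N + N" for j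
  proof -
    have "norm (?x j - ?y j) \<le> j * (a + 1) ^ j * \<epsilon> * norm v"
      by (rule sol_perturb[OF Lya_bound_shift[OF a]]) (use close \<epsilon> in auto)
    also have "\<dots> \<le> c * norm v"
      unfolding c_def using that \<epsilon> Lya_bound_ge_1[OF a]
      by (intro mult_right_mono mult_mono power_increasing) auto
    also have "\<dots> \<le> 1 / 8 * norm v"
      using \<epsilon>(3) unfolding c_def by (intro mult_right_mono) auto
    finally show ?thesis by simp
  qed
  have "4 * norm (?y N) \<le> max (norm v) (norm (?y (N + N)))"
    using conv unfolding convex_norms_def by blast
  moreover have "norm (?x N) \<le> norm (?y N) + norm v / 8"
    using diff[of N] norm_triangle_ineq2[of "?x N" "?y N"] by simp
  moreover have "norm (?y (N + N)) \<le> norm (?x (N + N)) + norm v / 8"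
    using diff[of "N + N"] norm_triangle_ineq3[of "?x (N + N)" "?y (N + N)"] by linarith
  ultimately show "2 * norm (?x N) \<le> max (norm v) (norm (?x (N + N)))"
    using norm_ge_zero[of v] norm_ge_zero[of "?x (N + N)"] by linarith
qed

lemma ED_subset_BD: "ED \<subseteq> BD"
proof
  fix A :: "nat \<Rightarrow> real^'d^'d"
  assume "A \<in> ED"
  then obtain L1 L2 \<alpha> K where A: "A \<in> LLya" and L: "direct_sum_decomp L1 L2" and pos: "0 < \<alpha>" "0 < K"
    and dich: "\<forall>n m. m \<le> n \<longrightarrow>
          (\<forall>x0\<in>L1. norm (sol A x0 n) \<le> K * exp (- \<alpha> * real (n - m)) * norm (sol A x0 m)) \<and>
          (\<forall>x0\<in>L2. norm (sol A x0 n) \<ge> inverse K * exp (\<alpha> * real (n - m)) * norm (sol A x0 m))"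
    unfolding ED_def by blast
  have "\<exists>C1 C2 :: real^'d \<Rightarrow> real. (\<forall>x. C1 x > 0) \<and> (\<forall>x. C2 x > 0) \<and>
          (\<forall>n m. m \<le> n \<longrightarrow>
            (\<forall>x0\<in>L1. norm (sol A x0 n) \<le> C1 x0 * exp (- \<alpha> * real (n - m)) * norm (sol A x0 m)) \<and>
            (\<forall>x0\<in>L2. norm (sol A x0 n) \<ge> C2 x0 * exp (\<alpha> * real (n - m)) * norm (sol A x0 m)))"
    using dich pos by (intro exI[of _ "\<lambda>_. K"] exI[of _ "\<lambda>_. inverse K"]) simp
  with A L pos show "A \<in> BD"
    unfolding BD_def by blast
qed

text \<open>Restates the metric notion as a vectorwise estimate, the form in which all perturbations
  are constructed and controlled.\<close>

lemma interior_of_LLya_topology: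
  "A \<in> LLya_topology interior_of S \<longleftrightarrow> A \<in> LLya \<and>
    (\<exists>\<epsilon>>0. \<forall>B\<in>LLya. (\<forall>n v. norm (B n *v v - A n *v v) \<le> \<epsilon> * norm v) \<longrightarrow> B \<in> S)"
proof -
  interpret M: Metric_space Linf "Linf_dist :: (nat \<Rightarrow> real^'d^'d) \<Rightarrow> _" by (rule Metric_space_Linf)
  have sub: "LLya \<subseteq> Linf" by (auto simp: LLya_def)
  show ?thesis
  proof
    assume "A \<in> LLya_topology interior_of S"
    then obtain U where U: "openin M.mtopology U" "A \<in> U \<inter> LLya" "U \<inter> LLya \<subseteq> S"
      unfolding interior_of_def LLya_topology_def openin_subtopology by auto
    then obtain r where r: "0 < r" "M.mball A r \<subseteq> U"
      using M.openin_mtopology by blast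
    \<comment> \<open>Bounds on the individual terms give only a weak inequality for the supremum;
      half the radius restores strictness.\<close>
    have "B \<in> S" if B: "B \<in> LLya" "\<forall>n v. norm (B n *v v - A n *v v) \<le> r / 2 * norm v" for B
    proof -
      have "mat_opnorm (A n - B n) \<le> r / 2" for n
        using B(2) by (intro mat_opnorm_le) (simp add: matrix_vector_mult_diff_rdistrib norm_minus_commute)
      then have "Linf_norm (\<lambda>n. A n - B n) \<le> r / 2"
        unfolding Linf_norm_def by (intro cSUP_least) auto
      then have "B \<in> M.mball A r"
        using U(2) B(1) sub \<open>0 < r\<close> by (auto simp: Linf_dist_def)
      then show "B \<in> S" using U(3) r(2) B(1) by blast
    qed
    then show "A \<in> LLya \<and> (\<exists>\<epsilon>>0. \<forall>B\<in>LLya. (\<forall>n v. norm (B n *v v - A n *v v) \<le> \<epsilon> * norm v) \<longrightarrow> B \<in> S)"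
      using U(2) \<open>0 < r\<close> by (intro conjI exI[of _ "r / 2"]) auto
  next
    assume "A \<in> LLya \<and> (\<exists>\<epsilon>>0. \<forall>B\<in>LLya. (\<forall>n v. norm (B n *v v - A n *v v) \<le> \<epsilon> * norm v) \<longrightarrow> B \<in> S)"
    then obtain \<epsilon> where A: "A \<in> LLya" and "0 < \<epsilon>"
      and \<epsilon>: "\<And>B. B \<in> LLya \<Longrightarrow> (\<And>n v. norm (B n *v v - A n *v v) \<le> \<epsilon> * norm v) \<Longrightarrow> B \<in> S"
      by blast
    have "B \<in> S" if "B \<in> M.mball A \<epsilon> \<inter> LLya" for B
    proof (rule \<epsilon>)
      fix n v
      have AB: "A \<in> Linf" "B \<in> Linf" and "Linf_norm (\<lambda>n. A n - B n) < \<epsilon>"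
        using that by (auto simp: Linf_dist_def)
      then have "mat_opnorm (A n - B n) \<le> \<epsilon>"
        using mat_opnorm_le_Linf_norm[OF Linf_diff[OF AB], of n] by simp
      then have "norm ((A n - B n) *v v) \<le> \<epsilon> * norm v"
        by (meson mult_right_mono norm_ge_zero norm_mult_vec_le_mat_opnorm order_trans)
      then show "norm (B n *v v - A n *v v) \<le> \<epsilon> * norm v"
        by (simp add: matrix_vector_mult_diff_rdistrib norm_minus_commute)
    qed (use that in blast)
    moreover have "openin LLya_topology (M.mball A \<epsilon> \<inter> LLya)"
      unfolding LLya_topology_def openin_subtopology by blast
    moreover have "A \<in> M.mball A \<epsilon> \<inter> LLya"
      using A sub \<open>0 < \<epsilon>\<close> by auto
    ultimately show "A \<in> LLya_topology interior_of S"
      unfolding interior_of_def by blast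
  qed
qed

text \<open>The lower bound \<open>1 / a\<close> loses at most \<open>\<epsilon>\<close>, and
  \<open>\<epsilon>\<close> is at most half of it.\<close>

lemma Lya_bound_perturb:
  assumes a: "Lya_bound A a" and close: "\<And>n v. norm (B n *v v - A n *v v) \<le> \<epsilon> * norm v"
    and \<epsilon>: "2 * a * \<epsilon> \<le> 1"
  shows "Lya_bound B (2 * a)"
proof -
  have "1 \<le> a" by (rule Lya_bound_ge_1[OF a])
  have "a * \<epsilon> \<le> 1 / 2" using \<epsilon> by simp
  have "norm (B n *v v) \<le> 2 * a * norm v" "norm v \<le> 2 * a * norm (B n *v v)" for n v
  proof -
    have A: "norm (A n *v v) \<le> a * norm v" "norm v \<le> a * norm (A n *v v)"
      using a by (auto simp: Lya_bound_def)
    have \<epsilon>v: "a * (\<epsilon> * norm v) \<le> norm v / 2"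
      using mult_right_mono[OF \<open>a * \<epsilon> \<le> 1 / 2\<close>, of "norm v"] by simp
    have "\<epsilon> * norm v \<le> a * (\<epsilon> * norm v)"
      using order_trans[OF norm_ge_zero close, of v] \<open>1 \<le> a\<close> by (simp add: mult_le_cancel_right1)
    then have "norm (B n *v v) \<le> a * norm v + norm v / 2"
      using A(1) close[of n v] \<epsilon>v norm_triangle_ineq2[of "B n *v v" "A n *v v"] by linarith
    also have "\<dots> \<le> 2 * a * norm v"
      using mult_right_mono[OF \<open>1 \<le> a\<close>, of "norm v"] norm_ge_zero[of v] by linarith
    finally show "norm (B n *v v) \<le> 2 * a * norm v" .
    have "norm (A n *v v) \<le> norm (B n *v v) + \<epsilon> * norm v"
      using close[of n v] norm_triangle_ineq3[of "B n *v v" "A n *v v"] by linarith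
    then have "a * norm (A n *v v) \<le> a * norm (B n *v v) + a * (\<epsilon> * norm v)"
      using mult_left_mono[of _ _ a] \<open>1 \<le> a\<close> by (fastforce simp flip: distrib_left)
    then show "norm v \<le> 2 * a * norm (B n *v v)"
      using A(2) \<epsilon>v by linarith
  qed
  then show ?thesis using \<open>1 \<le> a\<close> by (simp add: Lya_bound_def)
qed

lemma ED_subset_interior_BD: "ED \<subseteq> LLya_topology interior_of BD"
proof
  fix A :: "nat \<Rightarrow> real^'d^'d"
  assume "A \<in> ED"
  then obtain N where "0 < N" and N: "convex_norms A N 4" by (rule ED_imp_convex_norms)
  have "A \<in> LLya" using \<open>A \<in> ED\<close> by (simp add: ED_def)
  then obtain a where a: "Lya_bound A a" using LLya_iff by blast
  have "1 \<le> a" by (rule Lya_bound_ge_1[OF a])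
  define c where "c = real (N + N) * (a + 1) ^ (N + N)"
  have "0 < c" using \<open>0 < N\<close> \<open>1 \<le> a\<close> by (simp add: c_def)
  \<comment> \<open>The first entry keeps the perturbed sequence in \<open>LLya\<close>, the second
    preserves convexity of the norms with constant 2.\<close>
  define \<epsilon> where "\<epsilon> = min (1 / (2 * a)) (1 / (8 * c))"
  have "0 < \<epsilon>" using \<open>0 < c\<close> \<open>1 \<le> a\<close> by (simp add: \<epsilon>_def)
  have "\<epsilon> \<le> 1 / (2 * a)" "\<epsilon> \<le> 1 / (8 * c)" by (simp_all add: \<epsilon>_def)
  then have \<epsilon>: "2 * a * \<epsilon> \<le> 1" "8 * (c * \<epsilon>) \<le> 1"
    using \<open>0 < c\<close> \<open>1 \<le> a\<close> by (simp_all add: field_simps)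
  have "\<epsilon> \<le> a * \<epsilon>" using \<open>0 < \<epsilon>\<close> \<open>1 \<le> a\<close> by simp
  with \<epsilon>(1) \<open>0 < \<epsilon>\<close> have "\<epsilon> \<le> 1" by linarith
  have "B \<in> BD" if B: "\<forall>n v. norm (B n *v v - A n *v v) \<le> \<epsilon> * norm v" for B
  proof -
    have "Lya_bound B (2 * a)"
      using B \<epsilon>(1) by (intro Lya_bound_perturb[OF a]) auto
    moreover have "convex_norms B N 2"
      using B \<open>0 < \<epsilon>\<close> \<open>\<epsilon> \<le> 1\<close> \<epsilon>(2) by (intro convex_norms_perturb[OF a _ _ _ _ N]) (auto simp: c_def)
    ultimately show ?thesis
      using convex_norms_imp_ED \<open>0 < N\<close> ED_subset_BD by blast
  qed
  with \<open>A \<in> LLya\<close> \<open>0 < \<epsilon>\<close> show "A \<in> LLya_topology interior_of BD"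
    unfolding interior_of_LLya_topology by blast
qed

section \<open>Leaving the Bohl dichotomy by a small perturbation\<close>

text \<open>\<open>R n\<close> sends \<open>x n\<close> to the defect and annihilates its orthogonal
  complement, so its norm is the defect divided by the norm of \<open>x n\<close>. This is why
  errors are measured relative to the current size.\<close>

lemma perturb_to_pseudo_orbit:
  fixes x :: "nat \<Rightarrow> real^'d"
  assumes "\<And>n. x n \<noteq> 0" and pseudo: "\<And>n. norm (x (Suc n) - A n *v x n) \<le> \<epsilon> * norm (x n)"
  obtains B where "\<And>n v. norm (B n *v v - A n *v v) \<le> \<epsilon> * norm v" "\<And>n. sol B (x 0) n = x n"
proof -
  define e where "e n = x (Suc n) - A n *v x n" for n
  define R where "R n v = ((x n \<bullet> v) / (x n \<bullet> x n)) *\<^sub>R e n" for n v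
  define B where "B n = A n + matrix (R n)" for n
  have "linear (R n)" for n
    by (rule linearI) (simp_all add: R_def inner_right_distrib add_divide_distrib scaleR_add_left)
  then have B: "B n *v v = A n *v v + R n v" for n v
    by (simp add: B_def matrix_vector_mult_add_rdistrib matrix_works)
  have "norm (R n v) \<le> \<epsilon> * norm v" for n v
  proof -
    have "norm (R n v) = \<bar>x n \<bullet> v\<bar> / (norm (x n))\<^sup>2 * norm (e n)"
      by (simp add: R_def power2_norm_eq_inner)
    also have "\<dots> \<le> (norm (x n) * norm v) / (norm (x n))\<^sup>2 * (\<epsilon> * norm (x n))"
      using pseudo[of n] by (intro mult_mono divide_right_mono Cauchy_Schwarz_ineq2) (auto simp: e_def)
    also have "\<dots> = \<epsilon> * norm v"
      using assms(1)[of n] by (simp add: power2_eq_square)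
    finally show ?thesis .
  qed
  then have 1: "norm (B n *v v - A n *v v) \<le> \<epsilon> * norm v" for n v
    by (simp add: B)
  have 2: "sol B (x 0) n = x n" for n
    using assms(1) by (induction n) (simp_all add: B R_def e_def)
  show thesis by (rule that[OF 1 2])
qed

text \<open>A single solution uses only its own Bohl constants, so their lack of uniformity is
  harmless. With no \<open>L2\<close> component it decays exponentially, against
  \<open>slow_decay\<close>; otherwise that component eventually dominates and forces growth,
  against \<open>slow_growth\<close>.\<close>

lemma BD_no_balanced_solution:
  fixes B :: "nat \<Rightarrow> real^'d^'d"
  assumes "B \<in> BD" "x \<noteq> 0" "0 < c"
    and slow_decay: "\<And>k. \<exists>m n. k \<le> m \<and> m + k \<le> n \<and> c * norm (sol B x m) \<le> norm (sol B x n)"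
    and slow_growth: "\<And>k. \<exists>m n. k \<le> m \<and> m + k \<le> n \<and> c * norm (sol B x n) \<le> norm (sol B x m)"
  shows False
proof -
  from assms(1) obtain L1 L2 \<alpha> C1 C2 where "B \<in> LLya" and L: "direct_sum_decomp L1 L2" and "0 < \<alpha>"
    and C: "\<forall>x. (C1 :: real^'d \<Rightarrow> real) x > 0" "\<forall>x. (C2 :: real^'d \<Rightarrow> real) x > 0"
    and dich: "\<forall>n m. m \<le> n \<longrightarrow>
            (\<forall>x0\<in>L1. norm (sol B x0 n) \<le> C1 x0 * exp (- \<alpha> * real (n - m)) * norm (sol B x0 m)) \<and>
            (\<forall>x0\<in>L2. norm (sol B x0 n) \<ge> C2 x0 * exp (\<alpha> * real (n - m)) * norm (sol B x0 m))"
    unfolding BD_def by blast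
  obtain b where b: "Lya_bound B b" using \<open>B \<in> LLya\<close> LLya_iff by blast
  have pos: "0 < norm (sol B y n)" if "y \<noteq> 0" for y n
    using sol_eq_0_iff[OF b, of y n] that by simp
  obtain p q where pq: "p \<in> L1" "q \<in> L2" and x: "x = p + q"
    using L unfolding direct_sum_decomp_def by blast
  show False
  proof (cases "q = 0")
    case True
    then have "x \<in> L1" using pq x by simp
    obtain k where k: "\<And>n. k \<le> n \<Longrightarrow> C1 x / c < exp (\<alpha> * real n)"
      using exp_large[OF \<open>0 < \<alpha>\<close>] by blast
    obtain m n where mn: "k \<le> m" "m + k \<le> n" "c * norm (sol B x m) \<le> norm (sol B x n)"
      using slow_decay by blast
    have "c * norm (sol B x m) \<le> C1 x * exp (- \<alpha> * real (n - m)) * norm (sol B x m)"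
      using dich[rule_format, of m n] mn \<open>x \<in> L1\<close> by force
    then have "c \<le> C1 x * exp (- \<alpha> * real (n - m))"
      using pos[OF \<open>x \<noteq> 0\<close>, of m] by simp
    then have "c * exp (\<alpha> * real (n - m)) \<le> C1 x"
      by (simp add: exp_minus field_simps)
    moreover have "C1 x < c * exp (\<alpha> * real (n - m))"
      using k[of "n - m"] mn \<open>0 < c\<close> by (simp add: field_simps)
    ultimately show False by simp
  next
    case False
    let ?r = "2 * C1 p * norm p / (C2 q * norm q)"
    obtain k1 where k1: "\<And>n. k1 \<le> n \<Longrightarrow> ?r < exp (\<alpha> * real n)"
      using exp_large[OF \<open>0 < \<alpha>\<close>] by blast
    have C2q: "0 < C2 q * norm q" using False C by simp
    have dom: "2 * norm (sol B p n) \<le> norm (sol B q n)" if "k1 \<le> n" for n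
    proof -
      have "2 * norm (sol B p n) \<le> 2 * (C1 p * exp (- \<alpha> * real n) * norm p)"
        using dich[rule_format, of 0 n] pq by simp
      also have "\<dots> \<le> 2 * (C1 p * 1 * norm p)"
        using \<open>0 < \<alpha>\<close> C by (intro mult_left_mono mult_right_mono) (auto simp: less_imp_le)
      also have "\<dots> \<le> C2 q * norm q * exp (\<alpha> * real n)"
        using k1[OF that] C2q by (simp add: pos_divide_less_eq mult_ac)
      also have "\<dots> \<le> norm (sol B q n)"
        using dich[rule_format, of 0 n] pq by (simp add: mult_ac)
      finally show ?thesis .
    qed
    \<comment> \<open>Beyond \<open>k1\<close> the solution is at most 3/2 and at least 1/2 of its
      \<open>q\<close> component. The two losses combine to the 3 that the growth of
      \<open>q\<close> must exceed.\<close>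
    obtain k2 where k2: "\<And>n. k2 \<le> n \<Longrightarrow> 3 / (c * C2 q) < exp (\<alpha> * real n)"
      using exp_large[OF \<open>0 < \<alpha>\<close>] by blast
    obtain m n where mn: "max k1 k2 \<le> m" "m + max k1 k2 \<le> n" "c * norm (sol B x n) \<le> norm (sol B x m)"
      using slow_growth by blast
    let ?E = "exp (\<alpha> * real (n - m))"
    have E: "3 < c * C2 q * ?E"
      using k2[of "n - m"] mn C \<open>0 < c\<close> by (simp add: pos_divide_less_eq mult_ac)
    have "norm (sol B x m) \<le> norm (sol B p m) + norm (sol B q m)"
      unfolding x sol_add by (rule norm_triangle_ineq)
    then have xm: "2 * norm (sol B x m) \<le> 3 * norm (sol B q m)"
      using dom[of m] mn by simp
    have "norm (sol B q n) \<le> norm (sol B x n) + norm (sol B p n)"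
      unfolding x sol_add by (metis add.commute norm_triangle_ineq4 add_diff_cancel_left')
    then have xn: "norm (sol B q n) \<le> 2 * norm (sol B x n)"
      using dom[of n] mn by simp
    have "C2 q * ?E * norm (sol B q m) \<le> norm (sol B q n)"
      using dich[rule_format, of m n] pq mn by simp
    then have "c * (C2 q * ?E * norm (sol B q m)) \<le> c * (2 * norm (sol B x n))"
      using xn \<open>0 < c\<close> by (intro mult_left_mono) auto
    also have "\<dots> \<le> 3 * norm (sol B q m)"
      using mn(3) xm by linarith
    finally have "c * C2 q * ?E * norm (sol B q m) \<le> 3 * norm (sol B q m)"
      by (simp add: mult.assoc)
    then show False
      using E pos[OF False, of m] by simp
  qed
qed

text \<open>Every \<open>\<xi> k\<close> is an initial value at time 0, although its solution is
  followed only on \<open>[p k, p (Suc k))\<close>. The jump is compared with the norm one step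
  before the junction, which costs the factor \<open>a\<close>.\<close>

lemma glue_solutions:
  assumes a: "Lya_bound A a" and p: "strict_mono p" "p 0 = 0" and nz: "\<And>k. \<xi> k \<noteq> 0" and "0 \<le> \<eta>"
    and jump: "\<And>k. norm (sol A (\<xi> (Suc k)) (p (Suc k)) - sol A (\<xi> k) (p (Suc k)))
      \<le> \<eta> * norm (sol A (\<xi> k) (p (Suc k)))"
  obtains x where "\<And>n. x n \<noteq> 0" "\<And>n. norm (x (Suc n) - A n *v x n) \<le> a * \<eta> * norm (x n)"
    "\<And>k n. p k \<le> n \<Longrightarrow> n < p (Suc k) \<Longrightarrow> x n = sol A (\<xi> k) n"
proof -
  define piece where "piece n = (LEAST j. n < p (Suc j))" for n
  have piece: "piece n = k" if "p k \<le> n" "n < p (Suc k)" for k n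
    unfolding piece_def
  proof (rule Least_equality)
    fix j
    assume "n < p (Suc j)"
    with that(1) have "p k < p (Suc j)" by simp
    then show "k \<le> j" using strict_mono_less[OF p(1)] by simp
  qed fact
  have ex: "\<exists>k. p k \<le> n \<and> n < p (Suc k)" for n
  proof (intro exI conjI)
    have "n < p (Suc n)"
      using strict_mono_imp_increasing[OF p(1), of "Suc n"] by simp
    then show "n < p (Suc (piece n))"
      unfolding piece_def by (rule LeastI)
    show "p (piece n) \<le> n"
    proof (cases "piece n")
      case (Suc j)
      then have "\<not> n < p (Suc j)"
        unfolding piece_def by (intro not_less_Least) simp
      with Suc show ?thesis by simp
    qed (simp add: p(2))
  qed
  define x where "x n = sol A (\<xi> (piece n)) n" for n
  have x: "x n = sol A (\<xi> k) n" if "p k \<le> n" "n < p (Suc k)" for k n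
    by (simp add: x_def piece[OF that])
  have "x n \<noteq> 0" for n
    by (simp add: x_def sol_eq_0_iff[OF a] nz)
  moreover have "norm (x (Suc n) - A n *v x n) \<le> a * \<eta> * norm (x n)" for n
  proof -
    obtain k where k: "p k \<le> n" "n < p (Suc k)" using ex by blast
    show ?thesis
    proof (cases "Suc n < p (Suc k)")
      case True
      then show ?thesis
        using k x[of k n] x[of k "Suc n"] \<open>0 \<le> \<eta>\<close> Lya_bound_ge_1[OF a] by simp
    next
      case False
      then have n: "Suc n = p (Suc k)" using k by simp
      moreover have "p (Suc k) < p (Suc (Suc k))" using p(1) by (simp add: strict_mono_less)
      ultimately have "x (Suc n) = sol A (\<xi> (Suc k)) (Suc n)" by (intro x) auto
      then have "norm (x (Suc n) - A n *v x n) \<le> \<eta> * norm (sol A (\<xi> k) (Suc n))"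
        using jump[of k] k x[of k n] by (simp add: n[symmetric])
      also have "\<dots> \<le> \<eta> * (a * norm (x n))"
        using sol_Suc_bounds(1)[OF a, of "\<xi> k" n] k x[of k n] \<open>0 \<le> \<eta>\<close>
        by (intro mult_left_mono) simp_all
      finally show ?thesis by (simp add: mult_ac)
    qed
  qed
  ultimately show thesis using x by (rule that)
qed

text \<open>Common end of the decay and growth cases: \<open>c\<close> is fixed while the windows in
  piece \<open>k\<close> have length at least \<open>k\<close>, so the glued solution has balanced
  windows of every length, arbitrarily late.\<close>

lemma no_balanced_pieces:
  assumes a: "Lya_bound A a"
    and near: "\<And>B. B \<in> LLya \<Longrightarrow> (\<And>n v. norm (B n *v v - A n *v v) \<le> \<epsilon> * norm v) \<Longrightarrow> B \<in> BD"
    and \<epsilon>: "2 * a * \<epsilon> \<le> 1"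
    and p: "strict_mono p" "p 0 = 0" and nz: "\<And>k. \<xi> k \<noteq> 0" and \<eta>: "0 \<le> \<eta>" "a * \<eta> \<le> \<epsilon>"
    and jump: "\<And>k. norm (sol A (\<xi> (Suc k)) (p (Suc k)) - sol A (\<xi> k) (p (Suc k)))
      \<le> \<eta> * norm (sol A (\<xi> k) (p (Suc k)))"
    and "0 < c"
    and slow_decay: "\<And>k. \<exists>m n. p k \<le> m \<and> m + k \<le> n \<and> n < p (Suc k) \<and>
      c * norm (sol A (\<xi> k) m) \<le> norm (sol A (\<xi> k) n)"
    and slow_growth: "\<And>k. \<exists>m n. p k \<le> m \<and> m + k \<le> n \<and> n < p (Suc k) \<and>
      c * norm (sol A (\<xi> k) n) \<le> norm (sol A (\<xi> k) m)"
  shows False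
proof -
  obtain x where x_nz: "\<And>n. x n \<noteq> 0" and pseudo: "\<And>n. norm (x (Suc n) - A n *v x n) \<le> a * \<eta> * norm (x n)"
    and x: "\<And>k n. p k \<le> n \<Longrightarrow> n < p (Suc k) \<Longrightarrow> x n = sol A (\<xi> k) n"
    using glue_solutions[of A a p \<xi> \<eta>] a p nz \<eta> jump by blast
  have "norm (x (Suc n) - A n *v x n) \<le> \<epsilon> * norm (x n)" for n
    by (meson pseudo \<eta>(2) mult_right_mono norm_ge_zero order_trans)
  from x_nz this obtain B where close: "\<And>n v. norm (B n *v v - A n *v v) \<le> \<epsilon> * norm v"
    and B: "\<And>n. sol B (x 0) n = x n"
    by (rule perturb_to_pseudo_orbit) blast
  have "Lya_bound B (2 * a)" by (rule Lya_bound_perturb[OF a close \<epsilon>])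
  then have "B \<in> BD" using near close LLya_iff by blast
  have pk: "k \<le> p k" for k by (rule strict_mono_imp_increasing[OF p(1)])
  show False
  proof (rule BD_no_balanced_solution[OF \<open>B \<in> BD\<close> x_nz \<open>0 < c\<close>])
    fix k
    from slow_decay obtain m n where *: "p k \<le> m" "m + k \<le> n" "n < p (Suc k)"
      "c * norm (sol A (\<xi> k) m) \<le> norm (sol A (\<xi> k) n)" by blast
    then have "c * norm (x m) \<le> norm (x n)" using x[of k m] x[of k n] by simp
    then show "\<exists>m n. k \<le> m \<and> m + k \<le> n \<and> c * norm (sol B (x 0) m) \<le> norm (sol B (x 0) n)"
      using * pk[of k] unfolding B by (meson order_trans)
  next
    fix k
    from slow_growth obtain m n where *: "p k \<le> m" "m + k \<le> n" "n < p (Suc k)"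
      "c * norm (sol A (\<xi> k) n) \<le> norm (sol A (\<xi> k) m)" by blast
    then have "c * norm (x n) \<le> norm (x m)" using x[of k m] x[of k n] by simp
    then show "\<exists>m n. k \<le> m \<and> m + k \<le> n \<and> c * norm (sol B (x 0) n) \<le> norm (sol B (x 0) m)"
      using * pk[of k] unfolding B by (meson order_trans)
  qed
qed

text \<open>One of \<open>\<xi> + t u\<close> and \<open>\<xi> - t u\<close> has at least the component of \<open>t u\<close> at time \<open>q\<close>. This is used
  both with \<open>p < q\<close>, to prevent decay, and with \<open>q < p\<close>, to prevent growth.\<close>

lemma kick:
  assumes a: "Lya_bound A a" and L: "subspace L" and \<xi>: "\<xi> \<in> L" "\<xi> \<noteq> 0" and u: "u \<in> L" "u \<noteq> 0"
    and \<eta>: "0 < \<eta>" "\<eta> < 1" and uq: "norm (sol A u p) \<le> 2 * norm (sol A u q)"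
  obtains \<xi>' where "\<xi>' \<in> L" "\<xi>' \<noteq> 0" "norm (sol A \<xi>' p - sol A \<xi> p) \<le> \<eta> * norm (sol A \<xi> p)"
    "\<eta> * norm (sol A \<xi>' p) \<le> 4 * norm (sol A \<xi>' q)"
proof -
  let ?s = "\<lambda>y. norm (sol A y p)"
  have pos: "0 < ?s \<xi>" "0 < ?s u" using \<xi> u sol_eq_0_iff[OF a] by auto
  \<comment> \<open>Makes the kick exactly of relative size \<open>\<eta>\<close> at time
    \<open>p\<close>, whatever the size of \<open>u\<close>.\<close>
  define t where "t = \<eta> * ?s \<xi> / ?s u"
  have t: "\<bar>t\<bar> * ?s u = \<eta> * ?s \<xi>" using pos \<eta> by (simp add: t_def)
  have "\<exists>\<sigma>. \<bar>\<sigma>\<bar> = \<bar>t\<bar> \<and> \<bar>t\<bar> * norm (sol A u q) \<le> norm (sol A (\<xi> + \<sigma> *\<^sub>R u) q)"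
  proof (rule ccontr)
    assume "\<not> ?thesis"
    then have less: "norm (sol A (\<xi> + \<sigma> *\<^sub>R u) q) < \<bar>t\<bar> * norm (sol A u q)" if "\<bar>\<sigma>\<bar> = \<bar>t\<bar>" for \<sigma>
      using that by (meson not_le)
    have "sol A (\<xi> + t *\<^sub>R u) q - sol A (\<xi> + (- t) *\<^sub>R u) q = (2 * t) *\<^sub>R sol A u q"
      unfolding sol_add sol_scaleR by (simp add: algebra_simps flip: scaleR_add_left)
    then have "2 * (\<bar>t\<bar> * norm (sol A u q))
      \<le> norm (sol A (\<xi> + t *\<^sub>R u) q) + norm (sol A (\<xi> + (- t) *\<^sub>R u) q)"
      by (metis (no_types) abs_mult abs_numeral mult.assoc norm_scaleR norm_triangle_ineq4)
    then show False using less[of t] less[of "- t"] by simp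
  qed
  then obtain \<sigma> where \<sigma>: "\<bar>\<sigma>\<bar> = \<bar>t\<bar>" "\<bar>t\<bar> * norm (sol A u q) \<le> norm (sol A (\<xi> + \<sigma> *\<^sub>R u) q)" by blast
  define \<xi>' where "\<xi>' = \<xi> + \<sigma> *\<^sub>R u"
  have 1: "\<xi>' \<in> L" unfolding \<xi>'_def using L \<xi> u by (intro subspace_add subspace_scale)
  have 2: "norm (sol A \<xi>' p - sol A \<xi> p) \<le> \<eta> * ?s \<xi>"
    using \<sigma>(1) t by (simp add: \<xi>'_def sol_add sol_scaleR)
  have "\<eta> * ?s \<xi> < ?s \<xi>" using pos \<eta> by simp
  with 2 have 3: "\<xi>' \<noteq> 0" by auto
  \<comment> \<open>This 2 and the 2 in the hypothesis on \<open>u\<close> multiply to the 4 of the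
    conclusion.\<close>
  have "?s \<xi>' \<le> 2 * ?s \<xi>"
    using 2 \<open>\<eta> * ?s \<xi> < ?s \<xi>\<close> norm_triangle_ineq2[of "sol A \<xi>' p" "sol A \<xi> p"] by linarith
  then have "\<eta> * ?s \<xi>' \<le> \<eta> * (2 * ?s \<xi>)" using \<eta> by (intro mult_left_mono) auto
  also have "\<dots> = 2 * (\<bar>t\<bar> * ?s u)" using t by simp
  also have "\<dots> \<le> 2 * (\<bar>t\<bar> * (2 * norm (sol A u q)))"
    using uq by (intro mult_left_mono) auto
  also have "\<dots> \<le> 4 * norm (sol A \<xi>' q)" using \<sigma>(2) by (simp add: \<xi>'_def)
  finally have 4: "\<eta> * ?s \<xi>' \<le> 4 * norm (sol A \<xi>' q)" .
  show thesis by (rule that[OF 1 3 2 4])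
qed

section \<open>Compactness: uniform waiting times and limits of chains\<close>

lemma subspace_uniform_time:
  fixes L :: "'a::euclidean_space set" and V :: "nat \<Rightarrow> 'a set"
  assumes L: "subspace L" and opn: "\<And>t. open (V t)"
    and cover: "\<And>x. x \<in> L \<Longrightarrow> x \<noteq> 0 \<Longrightarrow> \<exists>t\<ge>k. x \<in> V t"
    and cone: "\<And>t c x. x \<in> V t \<Longrightarrow> 0 < c \<Longrightarrow> c *\<^sub>R x \<in> V t"
  obtains T where "k \<le> T" "\<And>x. x \<in> L \<Longrightarrow> x \<noteq> 0 \<Longrightarrow> \<exists>t. k \<le> t \<and> t \<le> T \<and> x \<in> V t"
proof -
  obtain T where T: "L - {0} \<subseteq> (\<Union>t\<in>{k..k + T}. V t)"
  proof (rule subspace_uniform_index[OF L, of "\<lambda>T. \<Union>t\<in>{k..k + T}. V t"])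
    show "mono (\<lambda>T. \<Union>t\<in>{k..k + T}. V t)" by (intro monoI UN_mono) auto
    show "\<exists>T. x \<in> (\<Union>t\<in>{k..k + T}. V t)" if x: "x \<in> L" "x \<noteq> 0" for x
    proof -
      obtain t where "k \<le> t" "x \<in> V t" using cover[OF x] by blast
      then show ?thesis by (intro exI[of _ t]) auto
    qed
    show "open (\<Union>t\<in>{k..k + T}. V t)" for T
      by (intro open_UN ballI opn)
    show "c *\<^sub>R x \<in> (\<Union>t\<in>{k..k + T}. V t)" if x: "x \<in> (\<Union>t\<in>{k..k + T}. V t)" and "0 < c" for T c x
    proof -
      obtain t where "t \<in> {k..k + T}" "x \<in> V t" using x by blast
      then show ?thesis using cone[of x t c] \<open>0 < c\<close> by blast
    qed
  qed
  have "\<exists>t. k \<le> t \<and> t \<le> k + T \<and> x \<in> V t" if x: "x \<in> L" "x \<noteq> 0" for x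
    using T x by fastforce
  then show thesis by (intro that[of "k + T"]) auto
qed

text \<open>The product of the \<open>C k\<close> is compact by Tychonoff's theorem, and the
  constraints are closed sets with the finite intersection property.\<close>

lemma compact_sequence_limit:
  fixes C :: "nat \<Rightarrow> 'a::topological_space set" and Z :: "nat \<Rightarrow> (nat \<Rightarrow> 'a) set"
  assumes C: "\<And>k. compact (C k)" and Z: "\<And>k. closed (Z k)"
    and ex: "\<And>K. \<exists>\<xi>. (\<forall>k. \<xi> k \<in> C k) \<and> (\<forall>k<K. \<xi> \<in> Z k)"
  shows "\<exists>\<xi>. (\<forall>k. \<xi> k \<in> C k) \<and> (\<forall>k. \<xi> \<in> Z k)"
proof -
  let ?P = "PiE UNIV C"
  have "compactin (product_topology (\<lambda>i. euclidean) UNIV) ?P"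
    using C by (simp add: compactin_PiE)
  then have "compact ?P"
    by (simp add: euclidean_product_topology)
  then have "?P \<inter> (\<Inter>k\<in>UNIV. Z k) \<noteq> {}"
  proof (rule compact_imp_fip_image)
    fix I :: "nat set"
    assume "finite I"
    obtain \<xi> where \<xi>: "\<forall>k. \<xi> k \<in> C k" "\<forall>k<Suc (Max (insert 0 I)). \<xi> \<in> Z k"
      using ex by blast
    have "k < Suc (Max (insert 0 I))" if "k \<in> I" for k
      using \<open>finite I\<close> that by (simp add: less_Suc_eq_le)
    with \<xi> show "?P \<inter> (\<Inter>k\<in>I. Z k) \<noteq> {}" by blast
  qed (rule Z)
  then show ?thesis by (auto simp: PiE_UNIV_domain)
qed

text \<open>For each starting time \<open>s\<close> separately, the solutions that have dropped
  below their size at \<open>s\<close> form open cones, so compactness applies. The dependence of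
  \<open>T\<close> on \<open>s\<close> remains.\<close>

lemma uniform_return_times:
  assumes L: "subspace L"
    and ret: "\<And>x s k. x \<in> L \<Longrightarrow> x \<noteq> 0 \<Longrightarrow> \<exists>t\<ge>k. norm (sol A x (s + t)) < norm (sol A x s)"
  shows "\<exists>T. \<forall>s k. k \<le> T s k \<and>
    (\<forall>x\<in>L - {0}. \<exists>t. k \<le> t \<and> t \<le> T s k \<and> norm (sol A x (s + t)) < norm (sol A x s))"
proof -
  have "\<exists>T. k \<le> T \<and> (\<forall>x\<in>L - {0}. \<exists>t. k \<le> t \<and> t \<le> T \<and> norm (sol A x (s + t)) < norm (sol A x s))" for s k
  proof -
    let ?V = "\<lambda>t. {x. norm (sol A x (s + t)) < norm (sol A x s)}"
    obtain T where "k \<le> T" "\<And>x. x \<in> L \<Longrightarrow> x \<noteq> 0 \<Longrightarrow> \<exists>t. k \<le> t \<and> t \<le> T \<and> x \<in> ?V t"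
    proof (rule subspace_uniform_time[OF L, of ?V])
      show "open (?V t)" for t by (intro open_Collect_less continuous_intros)
      show "\<exists>t\<ge>k. x \<in> ?V t" if "x \<in> L" "x \<noteq> 0" for x using ret[OF that] by simp
      show "c *\<^sub>R x \<in> ?V t" if "x \<in> ?V t" "0 < c" for t c x using that by (simp add: sol_scaleR)
    qed blast
    then show ?thesis by blast
  qed
  then show ?thesis by (intro choice allI)
qed

lemma uniform_escape_times:
  assumes L: "subspace L"
    and esc: "\<And>x s k. x \<in> L \<Longrightarrow> x \<noteq> 0 \<Longrightarrow> \<exists>t\<ge>k. norm (sol A x s) < norm (sol A x (s + t))"
  shows "\<exists>T. \<forall>s k. k \<le> T s k \<and>
    (\<forall>x\<in>L - {0}. \<exists>t. k \<le> t \<and> t \<le> T s k \<and> norm (sol A x s) < norm (sol A x (s + t)))"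
proof -
  have "\<exists>T. k \<le> T \<and> (\<forall>x\<in>L - {0}. \<exists>t. k \<le> t \<and> t \<le> T \<and> norm (sol A x s) < norm (sol A x (s + t)))" for s k
  proof -
    let ?V = "\<lambda>t. {x. norm (sol A x s) < norm (sol A x (s + t))}"
    obtain T where "k \<le> T" "\<And>x. x \<in> L \<Longrightarrow> x \<noteq> 0 \<Longrightarrow> \<exists>t. k \<le> t \<and> t \<le> T \<and> x \<in> ?V t"
    proof (rule subspace_uniform_time[OF L, of ?V])
      show "open (?V t)" for t by (intro open_Collect_less continuous_intros)
      show "\<exists>t\<ge>k. x \<in> ?V t" if "x \<in> L" "x \<noteq> 0" for x using esc[OF that] by simp
      show "c *\<^sub>R x \<in> ?V t" if "x \<in> ?V t" "0 < c" for t c x using that by (simp add: sol_scaleR)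
    qed blast
    then show ?thesis by blast
  qed
  then show ?thesis by (intro choice allI)
qed

section \<open>From nonuniform estimates to a forbidden solution\<close>

context
  fixes A :: "nat \<Rightarrow> real^'d^'d" and a \<epsilon> :: real and L :: "(real^'d) set"
  assumes a: "Lya_bound A a"
    and near: "\<And>B. B \<in> LLya \<Longrightarrow> (\<And>n v. norm (B n *v v - A n *v v) \<le> \<epsilon> * norm v) \<Longrightarrow> B \<in> BD"
    and \<epsilon>: "0 < \<epsilon>" "2 * a * \<epsilon> \<le> 1"
    and L: "subspace L"
begin

text \<open>If the decay on \<open>L\<close> is not uniform, there are arbitrarily late and long windows with a solution
  \<open>u\<close> in \<open>L\<close> that hardly decays. A solution is kicked towards \<open>u\<close> at the start of such a window, and
  then left alone until it has decayed below its size at the start.\<close>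

lemma decay_uniform:
  assumes ret: "\<And>x s k. x \<in> L \<Longrightarrow> x \<noteq> 0 \<Longrightarrow> \<exists>t\<ge>k. norm (sol A x (s + t)) < norm (sol A x s)"
  shows "\<exists>N>0. \<exists>m0. \<forall>m\<ge>m0. \<forall>x\<in>L. 2 * norm (sol A x (m + N)) \<le> norm (sol A x m)"
proof (rule ccontr)
  assume nonuniform: "\<not> ?thesis"
  have "1 \<le> a" by (rule Lya_bound_ge_1[OF a])
  define \<eta> where "\<eta> = \<epsilon> / a"
  have "\<epsilon> \<le> a * \<epsilon>" using \<epsilon> \<open>1 \<le> a\<close> by simp
  then have "\<epsilon> < 1" using \<epsilon> by linarith
  then have \<eta>: "0 < \<eta>" "\<eta> < 1" "a * \<eta> \<le> \<epsilon>"
    using \<epsilon> \<open>1 \<le> a\<close> by (auto simp: \<eta>_def field_simps)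
  obtain T where T: "\<And>s k. k \<le> T s k"
      "\<And>s k x. x \<in> L \<Longrightarrow> x \<noteq> 0 \<Longrightarrow> \<exists>t. k \<le> t \<and> t \<le> T s k \<and> norm (sol A x (s + t)) < norm (sol A x s)"
    using uniform_return_times[OF L ret] by (metis DiffI empty_iff insert_iff)
  have "\<exists>m u. m0 \<le> m \<and> u \<in> L \<and> norm (sol A u m) < 2 * norm (sol A u (m + Suc k))" for m0 k
    using nonuniform by (meson not_le zero_less_Suc)
  then obtain M U where MU: "\<And>m0 k. m0 \<le> M m0 k" "\<And>m0 k. U m0 k \<in> L"
      "\<And>m0 k. norm (sol A (U m0 k) (M m0 k)) < 2 * norm (sol A (U m0 k) (M m0 k + Suc k))"
    by metis
  have U_nz: "U m0 k \<noteq> 0" for m0 k using MU(3)[of m0 k] by auto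
  \<comment> \<open>Piece \<open>k\<close> is given time to return below its initial size; the next
    junction is the start of a later bad window of length \<open>Suc k\<close>, as required of piece
    \<open>Suc k\<close>.\<close>
  define p where "p = rec_nat 0 (\<lambda>k s. M (Suc (s + T s k)) k)"
  define u where "u k = U (Suc (p k + T (p k) k)) k" for k
  have p0: "p 0 = 0" and pS: "p (Suc k) = M (Suc (p k + T (p k) k)) k" for k
    by (simp_all add: p_def)
  have p_gap: "p k + T (p k) k < p (Suc k)" for k
    using MU(1)[of "Suc (p k + T (p k) k)" k] by (simp add: pS)
  then have "strict_mono p" by (intro strict_monoI_Suc) (meson le_add1 le_less_trans)
  have u: "norm (sol A (u k) (p (Suc k))) \<le> 2 * norm (sol A (u k) (p (Suc k) + Suc k))" for k
    using MU(3)[of "Suc (p k + T (p k) k)" k] by (simp add: u_def pS)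
  have uL: "u k \<in> L" "u k \<noteq> 0" for k using MU(2) U_nz by (simp_all add: u_def)
  have "\<exists>\<xi>. \<forall>k. (\<xi> k \<in> L \<and> \<xi> k \<noteq> 0) \<and>
     (norm (sol A (\<xi> (Suc k)) (p (Suc k)) - sol A (\<xi> k) (p (Suc k))) \<le> \<eta> * norm (sol A (\<xi> k) (p (Suc k))) \<and>
      \<eta> * norm (sol A (\<xi> (Suc k)) (p (Suc k))) \<le> 4 * norm (sol A (\<xi> (Suc k)) (p (Suc k) + Suc k)))"
  proof (rule dependent_nat_choice)
    show "\<exists>x. x \<in> L \<and> x \<noteq> 0" using uL by blast
  next
    fix x k
    assume x: "x \<in> L \<and> x \<noteq> 0"
    then obtain x' where "x' \<in> L" "x' \<noteq> 0"
      "norm (sol A x' (p (Suc k)) - sol A x (p (Suc k))) \<le> \<eta> * norm (sol A x (p (Suc k)))"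
      "\<eta> * norm (sol A x' (p (Suc k))) \<le> 4 * norm (sol A x' (p (Suc k) + Suc k))"
      using kick[OF a L _ _ uL \<eta>(1,2) u] by blast
    then show "\<exists>y. (y \<in> L \<and> y \<noteq> 0) \<and>
      norm (sol A y (p (Suc k)) - sol A x (p (Suc k))) \<le> \<eta> * norm (sol A x (p (Suc k))) \<and>
      \<eta> * norm (sol A y (p (Suc k))) \<le> 4 * norm (sol A y (p (Suc k) + Suc k))"
      by blast
  qed
  then obtain \<xi> where \<xi>: "\<And>k. \<xi> k \<in> L" "\<And>k. \<xi> k \<noteq> 0"
    and jump: "\<And>k. norm (sol A (\<xi> (Suc k)) (p (Suc k)) - sol A (\<xi> k) (p (Suc k)))
      \<le> \<eta> * norm (sol A (\<xi> k) (p (Suc k)))"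
    and window: "\<And>k. \<eta> * norm (sol A (\<xi> (Suc k)) (p (Suc k)))
      \<le> 4 * norm (sol A (\<xi> (Suc k)) (p (Suc k) + Suc k))"
    by blast
  show False
  proof (rule no_balanced_pieces[OF a near \<epsilon>(2) \<open>strict_mono p\<close> p0 \<xi>(2) less_imp_le[OF \<eta>(1)] \<eta>(3) jump])
    show "0 < \<eta> / 4" using \<eta> by simp
    fix k
    have small: "\<eta> / 4 * norm y \<le> norm y" for y :: "real^'d"
      using \<eta> by (intro mult_left_le_one_le) auto
    have "\<eta> / 4 * norm (sol A (\<xi> k) (p k)) \<le> norm (sol A (\<xi> k) (p k + k))"
    \<comment> \<open>Piece 0 is not preceded by a kick, but its window has length 0.\<close>
    proof (cases k)
      case 0
      then show ?thesis using small by simp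
    next
      case (Suc j)
      then show ?thesis using window[of j] by simp
    qed
    moreover have "p k + k < p (Suc k)" using p_gap[of k] T(1)[of k "p k"] by simp
    ultimately show "\<exists>m n. p k \<le> m \<and> m + k \<le> n \<and> n < p (Suc k) \<and>
        \<eta> / 4 * norm (sol A (\<xi> k) m) \<le> norm (sol A (\<xi> k) n)" by blast
    obtain t where t: "k \<le> t" "t \<le> T (p k) k" "norm (sol A (\<xi> k) (p k + t)) < norm (sol A (\<xi> k) (p k))"
      using T(2)[OF \<xi>] by blast
    then have "\<eta> / 4 * norm (sol A (\<xi> k) (p k + t)) \<le> norm (sol A (\<xi> k) (p k))"
      using small[of "sol A (\<xi> k) (p k + t)"] by linarith
    moreover have "p k + t < p (Suc k)" using t(2) p_gap[of k] by simp
    ultimately show "\<exists>m n. p k \<le> m \<and> m + k \<le> n \<and> n < p (Suc k) \<and>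
        \<eta> / 4 * norm (sol A (\<xi> k) n) \<le> norm (sol A (\<xi> k) m)"
      using t(1) by (intro exI[of _ "p k"] exI[of _ "p k + t"]) simp
  qed
qed

text \<open>If the growth on \<open>L\<close> is not uniform, kicks at the end of windows with a slowly growing solution
  make the solution small at the start of the window. Hence each piece depends on the next one: only
  finitely many pieces can be chosen, backwards in time, and a compactness argument is needed.\<close>

lemma growth_uniform:
  assumes esc: "\<And>x s k. x \<in> L \<Longrightarrow> x \<noteq> 0 \<Longrightarrow> \<exists>t\<ge>k. norm (sol A x s) < norm (sol A x (s + t))"
  shows "\<exists>N>0. \<exists>m0. \<forall>m\<ge>m0. \<forall>x\<in>L. 2 * norm (sol A x m) \<le> norm (sol A x (m + N))"
proof (rule ccontr)
  assume nonuniform: "\<not> ?thesis"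
  have "1 \<le> a" by (rule Lya_bound_ge_1[OF a])
  \<comment> \<open>The kick is measured relative to the later piece, the jump relative to the
    earlier one. Changing sides costs the factor 2, gluing the factor \<open>a\<close>.\<close>
  define \<eta> where "\<eta> = \<epsilon> / (2 * a)"
  have "\<epsilon> \<le> a * \<epsilon>" using \<epsilon> \<open>1 \<le> a\<close> by simp
  then have "\<epsilon> < 1" using \<epsilon> by linarith
  then have \<eta>: "0 < \<eta>" "\<eta> < 1" "\<eta> \<le> 1 / 2" "a * (2 * \<eta>) \<le> \<epsilon>"
    using \<epsilon> \<open>1 \<le> a\<close> by (auto simp: \<eta>_def field_simps)
  obtain T where T: "\<And>s k. k \<le> T s k"
      "\<And>s k x. x \<in> L \<Longrightarrow> x \<noteq> 0 \<Longrightarrow> \<exists>t. k \<le> t \<and> t \<le> T s k \<and> norm (sol A x s) < norm (sol A x (s + t))"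
    using uniform_escape_times[OF L esc] by (metis DiffI empty_iff insert_iff)
  have "\<exists>m u. m0 \<le> m \<and> u \<in> L \<and> norm (sol A u (m + Suc k)) < 2 * norm (sol A u m)" for m0 k
    using nonuniform by (meson not_le zero_less_Suc)
  then obtain M U where MU: "\<And>m0 k. m0 \<le> M m0 k" "\<And>m0 k. U m0 k \<in> L"
      "\<And>m0 k. norm (sol A (U m0 k) (M m0 k + Suc k)) < 2 * norm (sol A (U m0 k) (M m0 k))"
    by metis
  have U_nz: "U m0 k \<noteq> 0" for m0 k using MU(3)[of m0 k] by auto
  \<comment> \<open>Here a junction is the end of a bad window; \<open>m k\<close> is its
    start.\<close>
  define p where "p = rec_nat 0 (\<lambda>k s. M (Suc (s + T s k)) k + Suc k)"
  define m where "m k = M (Suc (p k + T (p k) k)) k" for k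
  define u where "u k = U (Suc (p k + T (p k) k)) k" for k
  have p0: "p 0 = 0" and pS: "p (Suc k) = m k + Suc k" for k
    by (simp_all add: p_def m_def)
  have p_gap: "p k + T (p k) k < m k" for k
    using MU(1)[of "Suc (p k + T (p k) k)" k] by (simp add: m_def)
  have "p k < p (Suc k)" for k using p_gap[of k] by (simp add: pS)
  then have "strict_mono p" by (rule strict_monoI_Suc)
  have u: "norm (sol A (u k) (p (Suc k))) \<le> 2 * norm (sol A (u k) (m k))" for k
    using MU(3)[of "Suc (p k + T (p k) k)" k] by (simp add: u_def m_def[symmetric] pS)
  have uL: "u k \<in> L" "u k \<noteq> 0" for k using MU(2) U_nz by (simp_all add: u_def)
  \<comment> \<open>The earlier piece \<open>x\<close> is the kicked copy of the later piece
    \<open>y\<close>, and the kick makes \<open>x\<close> large at the earlier time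
    \<open>m k\<close>.\<close>
  define R where "R k x y \<longleftrightarrow>
      norm (sol A x (p (Suc k)) - sol A y (p (Suc k))) \<le> \<eta> * norm (sol A y (p (Suc k))) \<and>
      \<eta> * norm (sol A x (p (Suc k))) \<le> 4 * norm (sol A x (m k))" for k x y
  have kick_R: "\<exists>x. x \<in> L \<and> x \<noteq> 0 \<and> R k x y" if "y \<in> L" "y \<noteq> 0" for k y
    using kick[OF a L that uL \<eta>(1,2) u] unfolding R_def by blast
  have R_scale: "R k (c *\<^sub>R x) (c *\<^sub>R y)" if "R k x y" for c k x y
  proof -
    have "\<bar>c\<bar> * norm (sol A x (p (Suc k)) - sol A y (p (Suc k))) \<le> \<bar>c\<bar> * (\<eta> * norm (sol A y (p (Suc k))))"
      "\<bar>c\<bar> * (\<eta> * norm (sol A x (p (Suc k)))) \<le> \<bar>c\<bar> * (4 * norm (sol A x (m k)))"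
      using that unfolding R_def by (auto intro: mult_left_mono)
    then show ?thesis
      unfolding R_def sol_scaleR by (simp add: mult_ac flip: scaleR_diff_right)
  qed
  have R_half: "norm (sol A y (p (Suc k))) \<le> 2 * norm (sol A x (p (Suc k)))" if "R k x y" for k x y
  proof -
    let ?x = "sol A x (p (Suc k))" and ?y = "sol A y (p (Suc k))"
    have "norm (?x - ?y) \<le> \<eta> * norm ?y" using that by (simp add: R_def)
    also have "\<dots> \<le> 1 / 2 * norm ?y" using \<eta> by (intro mult_right_mono) auto
    finally show ?thesis using norm_triangle_ineq3[of ?x ?y] by linarith
  qed
  have finite_chain: "\<exists>\<xi>. (\<forall>k. \<xi> k \<in> L \<and> \<xi> k \<noteq> 0) \<and> (\<forall>k. i \<le> k \<longrightarrow> k < i + j \<longrightarrow> R k (\<xi> k) (\<xi> (Suc k)))" for i j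
  proof (induction j arbitrary: i)
    case 0
    show ?case using uL by (intro exI[of _ "\<lambda>_. u 0"]) auto
  next
    case (Suc j)
    obtain \<xi> where \<xi>: "\<And>k. \<xi> k \<in> L \<and> \<xi> k \<noteq> 0" "\<And>k. Suc i \<le> k \<Longrightarrow> k < Suc i + j \<Longrightarrow> R k (\<xi> k) (\<xi> (Suc k))"
      using Suc[of "Suc i"] by blast
    obtain x where x: "x \<in> L \<and> x \<noteq> 0" "R i x (\<xi> (Suc i))"
      using kick_R \<xi>(1) by blast
    have "R k ((\<xi>(i := x)) k) ((\<xi>(i := x)) (Suc k))" if "i \<le> k" "k < i + Suc j" for k
      using that x(2) \<xi>(2)[of k] by (cases "k = i") auto
    with x(1) \<xi>(1) show ?case by (intro exI[of _ "\<xi>(i := x)"]) auto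
  qed
  \<comment> \<open>Going from one piece to the next means moving from time 0 to the junction,
    across it and back to time 0. The product of these costs bounds every piece once the first has
    norm 1.\<close>
  define b where "b k = (\<Prod>i<k. a ^ p (Suc i) * 2 * a ^ p (Suc i))" for k
  have R_norm: "norm y \<le> a ^ p (Suc k) * 2 * a ^ p (Suc k) * norm x" if "R k x y" for k x y
  proof -
    have "norm y \<le> a ^ p (Suc k) * norm (sol A y (p (Suc k)))"
      using sol_ge[OF a, of y 0 "p (Suc k)"] by simp
    also have "\<dots> \<le> a ^ p (Suc k) * (2 * norm (sol A x (p (Suc k))))"
      using R_half[OF that] \<open>1 \<le> a\<close> by (intro mult_left_mono) auto
    also have "\<dots> \<le> a ^ p (Suc k) * (2 * (a ^ p (Suc k) * norm x))"
      using sol_le[OF a, of x 0 "p (Suc k)"] \<open>1 \<le> a\<close> by (intro mult_left_mono) auto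
    finally show ?thesis by (simp add: mult_ac)
  qed
  \<comment> \<open>The sphere in position 0 prevents the limit chain from collapsing to 0;
    homogeneity of \<open>R\<close> permits this normalisation.\<close>
  define C where "C k = L \<inter> (if k = 0 then sphere 0 1 else cball 0 (b k))" for k
  have "\<exists>\<xi>. (\<forall>k. \<xi> k \<in> C k) \<and> (\<forall>k. \<xi> \<in> {\<xi>. R k (\<xi> k) (\<xi> (Suc k))})"
  proof (rule compact_sequence_limit)
    show "compact (C k)" for k
      unfolding C_def using closed_subspace[OF L] by (intro closed_Int_compact) auto
    show "closed {\<xi>. R k (\<xi> k) (\<xi> (Suc k))}" for k
      unfolding R_def by (intro closed_Collect_conj closed_Collect_le continuous_intros continuous_on_product_coordinates)
  next
    fix K
    obtain \<xi> where \<xi>: "\<And>k. \<xi> k \<in> L" "\<And>k. \<xi> k \<noteq> 0" "\<And>k. k < K \<Longrightarrow> R k (\<xi> k) (\<xi> (Suc k))"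
      using finite_chain[of 0 K] by auto
    \<comment> \<open>Only the relations below \<open>K\<close> are demanded, so the tail may be 0,
      which lies in every later \<open>C k\<close>.\<close>
    define \<zeta> where "\<zeta> k = (if k \<le> K then inverse (norm (\<xi> 0)) *\<^sub>R \<xi> k else 0)" for k
    have \<zeta>R: "R k (\<zeta> k) (\<zeta> (Suc k))" if "k < K" for k
      using R_scale[OF \<xi>(3)[OF that]] that by (simp add: \<zeta>_def)
    have "norm (\<zeta> 0) = 1" using \<xi>(2) by (simp add: \<zeta>_def)
    have "norm (\<zeta> k) \<le> b k" if "k \<le> K" for k
      using that
    proof (induction k)
      case 0
      show ?case using \<open>norm (\<zeta> 0) = 1\<close> by (simp add: b_def)
    next
      case (Suc k)
      have "norm (\<zeta> (Suc k)) \<le> a ^ p (Suc k) * 2 * a ^ p (Suc k) * norm (\<zeta> k)"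
        using Suc.prems by (intro R_norm \<zeta>R) simp
      also have "\<dots> \<le> a ^ p (Suc k) * 2 * a ^ p (Suc k) * b k"
        using Suc \<open>1 \<le> a\<close> by (intro mult_left_mono) auto
      finally show ?case by (simp add: b_def mult_ac)
    qed
    moreover have "norm (\<zeta> k) \<le> b k" if "\<not> k \<le> K" for k
      using that \<open>1 \<le> a\<close> by (auto simp: \<zeta>_def b_def intro!: prod_nonneg)
    moreover have "\<zeta> k \<in> L" for k
      using \<xi>(1) L by (auto simp: \<zeta>_def subspace_scale subspace_0)
    ultimately have "\<zeta> k \<in> C k" for k
      using \<open>norm (\<zeta> 0) = 1\<close> by (cases "k \<le> K") (auto simp: C_def)
    with \<zeta>R show "\<exists>\<xi>. (\<forall>k. \<xi> k \<in> C k) \<and> (\<forall>k<K. \<xi> \<in> {\<xi>. R k (\<xi> k) (\<xi> (Suc k))})"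
      by blast
  qed
  then obtain \<xi> where \<xi>C: "\<And>k. \<xi> k \<in> C k" and \<xi>R: "\<And>k. R k (\<xi> k) (\<xi> (Suc k))" by blast
  have \<xi>L: "\<xi> k \<in> L" for k using \<xi>C[of k] by (simp add: C_def)
  \<comment> \<open>The limit need not inherit nonvanishing from the finite chains, but a zero piece
    would force its predecessor to vanish, back to the unit sphere.\<close>
  have \<xi>nz: "\<xi> k \<noteq> 0" for k
  proof (induction k)
    case 0
    show ?case using \<xi>C[of 0] by (auto simp: C_def)
  next
    case (Suc k)
    show ?case
    proof
      assume "\<xi> (Suc k) = 0"
      then have "sol A (\<xi> k) (p (Suc k)) = 0" using \<xi>R[of k] by (simp add: R_def)
      with Suc show False by (simp add: sol_eq_0_iff[OF a])
    qed
  qed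
  have jump: "norm (sol A (\<xi> (Suc k)) (p (Suc k)) - sol A (\<xi> k) (p (Suc k)))
      \<le> 2 * \<eta> * norm (sol A (\<xi> k) (p (Suc k)))" for k
  proof -
    have "norm (sol A (\<xi> (Suc k)) (p (Suc k)) - sol A (\<xi> k) (p (Suc k)))
      \<le> \<eta> * norm (sol A (\<xi> (Suc k)) (p (Suc k)))"
      using \<xi>R[of k] by (simp add: R_def norm_minus_commute)
    also have "\<dots> \<le> \<eta> * (2 * norm (sol A (\<xi> k) (p (Suc k))))"
      using R_half[OF \<xi>R[of k]] \<eta> by (intro mult_left_mono) auto
    finally show ?thesis by simp
  qed
  have "0 \<le> 2 * \<eta>" using \<eta> by simp
  show False
  proof (rule no_balanced_pieces[OF a near \<epsilon>(2) \<open>strict_mono p\<close> p0 \<xi>nz \<open>0 \<le> 2 * \<eta>\<close> \<eta>(4) jump])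
    \<comment> \<open>Piece \<open>k\<close> stops one step before \<open>p (Suc k)\<close>, so its
      window ends at \<open>m k + k\<close>; this last step costs the factor
      \<open>a\<close>.\<close>
    show "0 < \<eta> / (4 * a)" using \<eta> \<open>1 \<le> a\<close> by simp
    fix k
    have "\<eta> / (4 * a) \<le> 1" using \<eta> \<open>1 \<le> a\<close> by (simp add: field_simps)
    then have small: "\<eta> / (4 * a) * norm y \<le> norm y" for y :: "real^'d"
      using \<eta> \<open>1 \<le> a\<close> by (intro mult_left_le_one_le) auto
    obtain t where t: "k \<le> t" "t \<le> T (p k) k" "norm (sol A (\<xi> k) (p k)) < norm (sol A (\<xi> k) (p k + t))"
      using T(2)[OF \<xi>L \<xi>nz] by blast
    then have "\<eta> / (4 * a) * norm (sol A (\<xi> k) (p k)) \<le> norm (sol A (\<xi> k) (p k + t))"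
      using small[of "sol A (\<xi> k) (p k)"] by linarith
    moreover have "p k + t < p (Suc k)" using t(2) p_gap[of k] by (simp add: pS)
    ultimately show "\<exists>m n. p k \<le> m \<and> m + k \<le> n \<and> n < p (Suc k) \<and>
        \<eta> / (4 * a) * norm (sol A (\<xi> k) m) \<le> norm (sol A (\<xi> k) n)"
      using t(1) by (intro exI[of _ "p k"] exI[of _ "p k + t"]) simp
    have "\<eta> * norm (sol A (\<xi> k) (m k + k)) \<le> \<eta> * (a * norm (sol A (\<xi> k) (p (Suc k))))"
      using sol_Suc_bounds(2)[OF a, of "\<xi> k" "m k + k"] \<eta> by (intro mult_left_mono) (auto simp: pS)
    also have "\<dots> \<le> a * (4 * norm (sol A (\<xi> k) (m k)))"
      using mult_left_mono[of "\<eta> * norm (sol A (\<xi> k) (p (Suc k)))" "4 * norm (sol A (\<xi> k) (m k))" a]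
        \<xi>R[of k] \<open>1 \<le> a\<close> by (simp add: R_def mult_ac)
    finally have "\<eta> / (4 * a) * norm (sol A (\<xi> k) (m k + k)) \<le> norm (sol A (\<xi> k) (m k))"
      using \<open>1 \<le> a\<close> by (simp add: field_simps)
    moreover have "p k \<le> m k" "m k + k < p (Suc k)" using p_gap[of k] by (simp_all add: pS)
    ultimately show "\<exists>m n. p k \<le> m \<and> m + k \<le> n \<and> n < p (Suc k) \<and>
        \<eta> / (4 * a) * norm (sol A (\<xi> k) n) \<le> norm (sol A (\<xi> k) m)"
      by blast
  qed
qed

end

text \<open>The Bohl constants depend on the solution but not on the starting time. Hence nonzero
  solutions in \<open>L1\<close> return below, and those in \<open>L2\<close> escape above, their
  size at any starting time, which is the input for the two uniformity results.\<close>

lemma interior_BD_subset_ED: "LLya_topology interior_of BD \<subseteq> ED"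
proof
  fix A :: "nat \<Rightarrow> real^'d^'d"
  assume A: "A \<in> LLya_topology interior_of BD"
  then obtain \<epsilon>0 where "A \<in> LLya" and "0 < \<epsilon>0"
    and \<epsilon>0: "\<And>B. B \<in> LLya \<Longrightarrow> (\<And>n v. norm (B n *v v - A n *v v) \<le> \<epsilon>0 * norm v) \<Longrightarrow> B \<in> BD"
    unfolding interior_of_LLya_topology by blast
  obtain a where a: "Lya_bound A a" using \<open>A \<in> LLya\<close> LLya_iff by blast
  have "1 \<le> a" by (rule Lya_bound_ge_1[OF a])
  \<comment> \<open>The second entry ensures that sequences this close to \<open>A\<close> remain in
    \<open>LLya\<close>.\<close>
  define \<epsilon> where "\<epsilon> = min \<epsilon>0 (1 / (2 * a))"
  have "0 < \<epsilon>" using \<open>0 < \<epsilon>0\<close> \<open>1 \<le> a\<close> by (simp add: \<epsilon>_def)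
  have "\<epsilon> \<le> 1 / (2 * a)" by (simp add: \<epsilon>_def)
  then have \<epsilon>: "2 * a * \<epsilon> \<le> 1" using \<open>1 \<le> a\<close> by (simp add: field_simps)
  have near: "B \<in> BD" if "B \<in> LLya" "\<And>n v. norm (B n *v v - A n *v v) \<le> \<epsilon> * norm v" for B
  proof (rule \<epsilon>0[OF that(1)])
    show "norm (B n *v v - A n *v v) \<le> \<epsilon>0 * norm v" for n v
      by (rule order_trans[OF that(2)]) (simp add: \<epsilon>_def mult_right_mono)
  qed
  have "A \<in> BD" by (rule subsetD[OF interior_of_subset A])
  then obtain L1 L2 \<alpha> C1 C2 where L: "direct_sum_decomp L1 L2" and "0 < \<alpha>"
    and C: "\<forall>x. (C1 :: real^'d \<Rightarrow> real) x > 0" "\<forall>x. (C2 :: real^'d \<Rightarrow> real) x > 0"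
    and dich: "\<forall>n m. m \<le> n \<longrightarrow>
            (\<forall>x0\<in>L1. norm (sol A x0 n) \<le> C1 x0 * exp (- \<alpha> * real (n - m)) * norm (sol A x0 m)) \<and>
            (\<forall>x0\<in>L2. norm (sol A x0 n) \<ge> C2 x0 * exp (\<alpha> * real (n - m)) * norm (sol A x0 m))"
    unfolding BD_def by blast
  have pos: "0 < norm (sol A x n)" if "x \<noteq> 0" for x n
    using sol_eq_0_iff[OF a, of x n] that by simp
  have ret: "\<exists>t\<ge>k. norm (sol A x (s + t)) < norm (sol A x s)" if x: "x \<in> L1" "x \<noteq> 0" for x s k
  proof -
    obtain t where t: "k \<le> t" "C1 x < exp (\<alpha> * real t)"
      using exp_large[OF \<open>0 < \<alpha>\<close>] by (meson nat_le_linear)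
    have "norm (sol A x (s + t)) \<le> C1 x * exp (- \<alpha> * real t) * norm (sol A x s)"
      using dich[rule_format, of s "s + t"] x by simp
    also have "\<dots> < 1 * norm (sol A x s)"
      using t(2) pos[OF x(2)] by (intro mult_strict_right_mono) (simp_all add: exp_minus field_simps)
    finally show ?thesis using t(1) by auto
  qed
  have esc: "\<exists>t\<ge>k. norm (sol A x s) < norm (sol A x (s + t))" if x: "x \<in> L2" "x \<noteq> 0" for x s k
  proof -
    obtain t where t: "k \<le> t" "1 / C2 x < exp (\<alpha> * real t)"
      using exp_large[OF \<open>0 < \<alpha>\<close>] by (meson nat_le_linear)
    have "1 * norm (sol A x s) < C2 x * exp (\<alpha> * real t) * norm (sol A x s)"
      using t(2) pos[OF x(2)] C by (intro mult_strict_right_mono) (simp_all add: pos_divide_less_eq mult.commute)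
    also have "\<dots> \<le> norm (sol A x (s + t))"
      using dich[rule_format, of s "s + t"] x by simp
    finally show ?thesis using t(1) by auto
  qed
  have sub: "subspace L1" "subspace L2" using L by (auto simp: direct_sum_decomp_def)
  obtain N1 m1 where N1: "0 < N1" "\<And>m x. m1 \<le> m \<Longrightarrow> x \<in> L1 \<Longrightarrow> 2 * norm (sol A x (m + N1)) \<le> norm (sol A x m)"
    using decay_uniform[OF a near \<open>0 < \<epsilon>\<close> \<epsilon> sub(1) ret] by blast
  obtain N2 m2 where N2: "0 < N2" "\<And>m x. m2 \<le> m \<Longrightarrow> x \<in> L2 \<Longrightarrow> 2 * norm (sol A x m) \<le> norm (sol A x (m + N2))"
    using growth_uniform[OF a near \<open>0 < \<epsilon>\<close> \<epsilon> sub(2) esc] by blast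
  show "A \<in> ED"
    by (rule uniform_imp_ED[OF a L N1(1) N2(1) N1(2) N2(2)])
qed

theorem theorem28:
  shows "LLya_topology interior_of (BD :: (nat \<Rightarrow> real^'d^'d) set) = ED"
  using interior_BD_subset_ED ED_subset_interior_BD by blast

end
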